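(* For every $x\in\mathcal M^B$ and $v\in T_x\mathcal M^B$: (1) $\bigl(\operatorname{grad}J^B(x),v\bigr)_x=\bigl(\operatorname{grad}J^B_x(0),v\bigr)_x=\bigl(\operatorname{grad}J(x),v\bigr)_{\mathcal E}.$ (2) The Hessian $\operatorname{Hess}J_x^B(0)$ is self-adjoint with respect to $(\cdot,\cdot)_x$, and for all $v,u\in T_x\mathcal M^B$, $$\bigl(\operatorname{Hess}J_x^B(0)[v],u\bigr)_x=\bigl([\operatorname{Hess}J(x)+\pi_x]v,u\bigr)_{\mathcal E}.$$ (3) The Taylor expansion of $J_x^B$ at $0$ along $v$ is $$J^B(R_x^B(v))=J_x^B(v)=J^B(x)+\bigl(\operatorname{grad}J^B(x),v\bigr)_x+\tfrac12\bigl(\operatorname{Hess}J_x^B(0)[v],v\bigr)_x+o(\|v\|_x^2)$$ $$=J(x)+\bigl(\operatorname{grad}J(x),v\bigr)_{\mathcal E}+\tfrac12\bigl([\operatorname{Hess}J(x)+\pi_x]v,v\bigr)_{\mathcal E}+o(\|v\|_{\mathcal E}^2).$$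
   Context: $\mathcal E,\mathcal Y$ are real Hilbert spaces. $\mathcal M\subset\mathcal E$ is a $C^2$ embedded submanifold; for $x\in\mathcal M$ the tangent space $T_x\mathcal M$ is identified with a closed linear subspace of $\mathcal E$. $B:\mathcal E\to\mathcal Y$ is a surjective bounded linear operator with adjoint $B^*$, $c\in\mathcal Y$, and $\mathcal M^B:=\{x\in\mathcal M: Bx=c\}$ is nonempty. For each $x\in\mathcal M$ a bounded linear projection $P_x:\mathcal E\to T_x\mathcal M$ onto $T_x\mathcal M$ is given (not necessarily orthogonal). Standing assumption: for every $x\in\mathcal M^B$, $L_x:=BP_xB^*:\mathcal Y\to\mathcal Y$ is invertible. Then $\mathcal M^B$ is a $C^2$ Hilbert submanifold with $T_x\mathcal M^B=T_x\mathcal M\cap\ker B$, endowed with the ambient Riemannian metric $(u,v)_x=(u,v)_{\mathcal E}$ and norm $\|\cdot\|_x$. Retraction on $\mathcal M$: for each $x\in\mathcal M$ a $C^2$ map $R_x:T_x\mathcal M\to\mathcal M$ is given with $R_x(0)=x$, $DR_x(0)=\mathrm{Id}$. The symmetric bounded bilinear map $\ell_x:T_x\mathcal M\times T_x\mathcal M\to\mathcal E$ is determined by $\frac{d^2}{d\alpha^2}R_x(\alpha v)|_{\alpha=0}=\ell_x(v,v)$. Implicit retraction: for $x\in\mathcal M^B$, by the implicit function theorem there are $r_x>0$ and a $C^2$ map $\delta_x:V_x^B\to\mathcal Y$, $V_x^B:=\{v\in T_x\mathcal M^B:\|v\|_x<r_x\}$, with $\delta_x(0)=0$ and $BR_x(v-P_xB^*\delta_x(v))=c$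 on $V_x^B$. Fix these and put $R_x^B(v):=R_x(v-P_xB^*\delta_x(v))\in\mathcal M^B$ for $v\in V_x^B$. Objective: $J:\mathcal E\to\mathbb R$ is $C^2$, bounded from below and coercive (bounded sublevel sets); $\operatorname{grad}J(x)\in\mathcal E$ and $\operatorname{Hess}J(x)\in\mathcal L(\mathcal E;\mathcal E)$ are its gradient and Hessian via Riesz identification, and both maps $\operatorname{grad}J$, $\operatorname{Hess}J$ send bounded sets to bounded sets. $J^B:=J|_{\mathcal M^B}$, $\operatorname{grad}J^B(x)\in T_x\mathcal M^B$ is its Riemannian gradient for $(\cdot,\cdot)_x$. The lifted objective is $J_x^B:V_x^B\to\mathbb R$, $J_x^B(\xi):=J^B(R_x^B(\xi))$; $\operatorname{grad}J_x^B(0)$ and $\operatorname{Hess}J_x^B(0)$ are its gradient and Hessian at $0$ on the Hilbert space $(T_x\mathcal M^B,(\cdot,\cdot)_x)$. With $\Lambda_x:=\mathrm{Id}_{\mathcal E}-P_xB^*L_x^{-1}B$, the operator $\pi_x:\mathcal E\to\mathcal E$ is the unique bounded self-adjoint operator with $(\pi_x[u_1],u_2)_{\mathcal E}=\bigl(\operatorname{grad}J(x),\Lambda_x(\ell_x(P_xu_1,P_xu_2))\bigr)_{\mathcal E}$ for all $u_1,u_2\in\mathcal E$. *)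

theory Defs
  imports "HOL-Analysis.Analysis" "HOL-Library.Landau_Symbols"
begin

section \<open>Twice continuously differentiable maps\<close>

text \<open>
  The intended domains \<open>S\<close> are relatively open subsets of a closed linear subspace \<open>T\<close> of a
  Hilbert space. Derivatives are taken within \<open>S\<close>, so that only their values on \<open>T\<close> matter.
  Operators on \<open>T\<close> extend to the whole space by composition with the orthogonal projection onto
  \<open>T\<close>, so asking for derivatives defined on the whole space is no restriction.
\<close>

definition C2_on :: "'a::real_normed_vector set \<Rightarrow> ('a \<Rightarrow> 'b::real_normed_vector) \<Rightarrow> bool" where
  "C2_on S f \<longleftrightarrow> (\<exists>(f' :: 'a \<Rightarrow> 'a \<Rightarrow>\<^sub>L 'b) (f'' :: 'a \<Rightarrow> 'a \<Rightarrow>\<^sub>L 'a \<Rightarrow>\<^sub>L 'b).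
     (\<forall>x\<in>S. (f has_derivative blinfun_apply (f' x)) (at x within S)) \<and>
     (\<forall>x\<in>S. (f' has_derivative blinfun_apply (f'' x)) (at x within S)) \<and>
     continuous_on S f'')"

section \<open>Embedded submanifolds of a Hilbert space\<close>

text \<open>The model spaces are closed subspaces; they are complemented since the space is Hilbert.\<close>

definition C2_submanifold :: "'a::{real_inner,banach} set \<Rightarrow> bool" where
  "C2_submanifold M \<longleftrightarrow>
     (\<forall>x\<in>M. \<exists>(U :: 'a set) (W :: 'a set) F \<phi> \<psi>. open U \<and> x \<in> U \<and> open W \<and> subspace F \<and> closed F \<and>
        homeomorphism U W \<phi> \<psi> \<and> C2_on U \<phi> \<and> C2_on W \<psi> \<and> \<phi> ` (U \<inter> M) = W \<inter> F)"

definition C1_curve_in ::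
  "'a::real_normed_vector set \<Rightarrow> 'a \<Rightarrow> 'a \<Rightarrow> (real \<Rightarrow> 'a) \<Rightarrow> bool" where
  "C1_curve_in N x v \<gamma> \<longleftrightarrow>
     (\<exists>e>0. \<gamma> C1_differentiable_on {-e<..<e} \<and> \<gamma> ` {-e<..<e} \<subseteq> N) \<and>
     \<gamma> 0 = x \<and> (\<gamma> has_vector_derivative v) (at 0)"

definition tangent_space :: "'a::real_normed_vector set \<Rightarrow> 'a \<Rightarrow> 'a set" where
  "tangent_space N x = {v. \<exists>\<gamma>. C1_curve_in N x v \<gamma>}"

text \<open>
  Riemannian gradient at \<open>x\<close>, for the ambient metric, of a function \<open>f\<close> given on the submanifold
  \<open>N\<close>. The differential of \<open>f\<close> at \<open>x\<close> in direction \<open>v\<close> is the derivative of \<open>f\<close> along any curve in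
  \<open>N\<close> through \<open>x\<close> with velocity \<open>v\<close>.
\<close>

definition riemannian_gradient ::
  "'a::real_inner set \<Rightarrow> ('a \<Rightarrow> real) \<Rightarrow> 'a \<Rightarrow> 'a" where
  "riemannian_gradient N f x =
     (THE g. g \<in> tangent_space N x \<and>
        (\<forall>v \<gamma>. C1_curve_in N x v \<gamma> \<longrightarrow>
           ((\<lambda>t. f (\<gamma> t)) has_real_derivative inner g v) (at 0)))"

section \<open>Gradients and Hessians on closed subspaces\<close>

text \<open>
  \<open>T\<close> is a closed subspace, regarded as a Hilbert space with the inherited inner product, and \<open>f\<close>
  needs to be meaningful only on a neighbourhood of \<open>x\<close> in \<open>T\<close>. The Hessian is the derivative of
  the gradient, that is, the Riesz representation of the second derivative; only its values on \<open>T\<close>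
  are determined.
\<close>

definition gradient_on :: "'a::real_inner set \<Rightarrow> ('a \<Rightarrow> real) \<Rightarrow> 'a \<Rightarrow> 'a" where
  "gradient_on T f x = (THE g. g \<in> T \<and> (f has_derivative (\<lambda>h. inner h g)) (at x within T))"

definition hessian_on :: "'a::real_inner set \<Rightarrow> ('a \<Rightarrow> real) \<Rightarrow> 'a \<Rightarrow> 'a \<Rightarrow> 'a" where
  "hessian_on T f x = frechet_derivative (gradient_on T f) (at x within T)"

abbreviation gradient :: "('a::real_inner \<Rightarrow> real) \<Rightarrow> 'a \<Rightarrow> 'a" where
  "gradient \<equiv> gradient_on UNIV"

abbreviation hessian :: "('a::real_inner \<Rightarrow> real) \<Rightarrow> 'a \<Rightarrow> 'a \<Rightarrow> 'a" where
  "hessian \<equiv> hessian_on UNIV"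

section \<open>Operators and bilinear maps\<close>

definition self_adjoint_on :: "'a::real_inner set \<Rightarrow> ('a \<Rightarrow> 'a) \<Rightarrow> bool" where
  "self_adjoint_on T A \<longleftrightarrow>
     (\<forall>v\<in>T. A v \<in> T) \<and> (\<forall>u\<in>T. \<forall>v\<in>T. inner (A u) v = inner u (A v))"

definition invertible_operator :: "('a::real_normed_vector \<Rightarrow> 'b::real_normed_vector) \<Rightarrow> bool" where
  "invertible_operator A \<longleftrightarrow> bounded_linear A \<and> bij A \<and> bounded_linear (inv A)"

definition bounded_projection_onto :: "'a::real_normed_vector set \<Rightarrow> ('a \<Rightarrow> 'a) \<Rightarrow> bool" where
  "bounded_projection_onto T A \<longleftrightarrow> bounded_linear A \<and> range A = T \<and> A \<circ> A = A"

definition sym_bounded_bilinear_on ::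
  "'a::real_normed_vector set \<Rightarrow> ('a \<Rightarrow> 'a \<Rightarrow> 'b::real_normed_vector) \<Rightarrow> bool" where
  "sym_bounded_bilinear_on T b \<longleftrightarrow>
     (\<forall>u\<in>T. \<forall>v\<in>T. b u v = b v u) \<and>
     (\<forall>u\<in>T. \<forall>v\<in>T. \<forall>w\<in>T. b (u + v) w = b u w + b v w) \<and>
     (\<forall>a. \<forall>u\<in>T. \<forall>w\<in>T. b (a *\<^sub>R u) w = a *\<^sub>R b u w) \<and>
     (\<exists>K. \<forall>u\<in>T. \<forall>v\<in>T. norm (b u v) \<le> K * norm u * norm v)"

section \<open>The constrained problem\<close>

definition constraint_set :: "'e set \<Rightarrow> ('e \<Rightarrow> 'y) \<Rightarrow> 'y \<Rightarrow> 'e set" where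
  "constraint_set M B c = {x \<in> M. B x = c}"

definition L_op ::
  "('e::real_inner \<Rightarrow> 'y::real_inner) \<Rightarrow> ('e \<Rightarrow> 'e \<Rightarrow> 'e) \<Rightarrow> 'e \<Rightarrow> 'y \<Rightarrow> 'y" where
  "L_op B P x y = B (P x (adjoint B y))"

definition Lambda_op ::
  "('e::real_inner \<Rightarrow> 'y::real_inner) \<Rightarrow> ('e \<Rightarrow> 'e \<Rightarrow> 'e) \<Rightarrow> 'e \<Rightarrow> 'e \<Rightarrow> 'e" where
  "Lambda_op B P x u = u - P x (adjoint B (inv (L_op B P x) (B u)))"

definition C2_retraction_at ::
  "'e::real_normed_vector set \<Rightarrow> 'e \<Rightarrow> ('e \<Rightarrow> 'e) \<Rightarrow> bool" where
  "C2_retraction_at M x \<rho> \<longleftrightarrow>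
     C2_on (tangent_space M x) \<rho> \<and> \<rho> ` tangent_space M x \<subseteq> M \<and> \<rho> 0 = x \<and>
     (\<rho> has_derivative (\<lambda>v. v)) (at 0 within tangent_space M x)"

text \<open>The map \<open>\<ell>\<^sub>x\<close> of a retraction; its values on \<open>T\<^sub>x M\<close> are determined by polarization.\<close>

definition retraction_ell ::
  "'e::real_normed_vector set \<Rightarrow> ('e \<Rightarrow> 'e \<Rightarrow> 'e) \<Rightarrow> 'e \<Rightarrow> 'e \<Rightarrow> 'e \<Rightarrow> 'e" where
  "retraction_ell M R x =
     (SOME b. sym_bounded_bilinear_on (tangent_space M x) b \<and>
        (\<forall>v\<in>tangent_space M x.
           ((\<lambda>\<alpha>. vector_derivative (\<lambda>\<beta>. R x (\<beta> *\<^sub>R v)) (at \<alpha>))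
              has_vector_derivative b v v) (at 0)))"

definition pi_op ::
  "'e::real_inner set \<Rightarrow> ('e \<Rightarrow> 'y::real_inner) \<Rightarrow> ('e \<Rightarrow> 'e \<Rightarrow> 'e) \<Rightarrow> ('e \<Rightarrow> 'e \<Rightarrow> 'e) \<Rightarrow>
     ('e \<Rightarrow> real) \<Rightarrow> 'e \<Rightarrow> 'e \<Rightarrow> 'e" where
  "pi_op M B P R J x =
     (THE p. bounded_linear p \<and> self_adjoint_on UNIV p \<and>
        (\<forall>u\<^sub>1 u\<^sub>2. inner (p u\<^sub>1) u\<^sub>2 =
           inner (gradient J x) (Lambda_op B P x (retraction_ell M R x (P x u\<^sub>1) (P x u\<^sub>2)))))"

text \<open>The domain \<open>V\<^sub>x\<^sup>B\<close>, for \<open>N\<close> the constrained manifold.\<close>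

definition retraction_domain ::
  "'e::real_normed_vector set \<Rightarrow> ('e \<Rightarrow> real) \<Rightarrow> 'e \<Rightarrow> 'e set" where
  "retraction_domain N r x = {v \<in> tangent_space N x. norm v < r x}"

definition implicit_retraction ::
  "('e::real_inner \<Rightarrow> 'y::real_inner) \<Rightarrow> ('e \<Rightarrow> 'e \<Rightarrow> 'e) \<Rightarrow> ('e \<Rightarrow> 'e \<Rightarrow> 'e) \<Rightarrow>
     ('e \<Rightarrow> 'e \<Rightarrow> 'y) \<Rightarrow> 'e \<Rightarrow> 'e \<Rightarrow> 'e" where
  "implicit_retraction B P R \<delta> x v = R x (v - P x (adjoint B (\<delta> x v)))"

definition constrained_objective ::
  "'e set \<Rightarrow> ('e \<Rightarrow> 'y) \<Rightarrow> 'y \<Rightarrow> ('e \<Rightarrow> real) \<Rightarrow> 'e \<Rightarrow> real" where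
  "constrained_objective M B c J = restrict J (constraint_set M B c)"

text \<open>Meaningful on \<open>V\<^sub>x\<^sup>B\<close>, a neighbourhood of \<open>0\<close> in the tangent space of the constrained manifold.\<close>

definition lifted_objective ::
  "'e::real_inner set \<Rightarrow> ('e \<Rightarrow> 'y::real_inner) \<Rightarrow> 'y \<Rightarrow> ('e \<Rightarrow> 'e \<Rightarrow> 'e) \<Rightarrow> ('e \<Rightarrow> 'e \<Rightarrow> 'e) \<Rightarrow>
     ('e \<Rightarrow> 'e \<Rightarrow> 'y) \<Rightarrow> ('e \<Rightarrow> real) \<Rightarrow> 'e \<Rightarrow> 'e \<Rightarrow> real" where
  "lifted_objective M B c P R \<delta> J x \<xi> =
     constrained_objective M B c J (implicit_retraction B P R \<delta> x \<xi>)"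

end

theory Submission
  imports Defs
begin

text \<open>
  Everything reduces to a second-order computation on the whole space, with one composite map.

  Fix \<open>x\<close> in the constraint set, let \<open>T\<close> be the tangent space of the constraint set at \<open>x\<close> and \<open>Q\<close>
  the orthogonal projection onto \<open>T\<close>. The retraction and the implicit function \<open>\<delta>\<close> live on subspaces;
  composing them with the projections \<open>P x\<close> and \<open>Q\<close> gives maps \<open>\<rho> = R x \<circ> P x\<close> and \<open>\<delta> x \<circ> Q\<close> on open
  subsets of the space. Then
  \<open>F \<xi> = \<rho> (Q \<xi> - B\<^sup>* (\<delta> x (Q \<xi>)))\<close> extends the implicit retraction to a ball around \<open>0\<close>, and
  \<open>J \<circ> F\<close> extends the lifted objective. Gradients and Hessians on \<open>T\<close> are the \<open>Q\<close>-projections of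
  those of the extension.

  Differentiating the identity \<open>B (F \<xi>) = c\<close> determines the derivatives of \<open>\<delta>\<close> at \<open>0\<close>. At first order
  it says \<open>L (D\<delta>(0) h) = 0\<close> with \<open>L = B P\<^sub>x B\<^sup>*\<close> injective, so \<open>D\<delta>(0) = 0\<close> and \<open>DF(0) = Q\<close>. At second
  order it says \<open>L (D\<^sup>2\<delta>(0)(h,k)) = B \<ell>(h,k)\<close>, hence
  \<open>D\<^sup>2F(0)(h,k) = \<ell>(h,k) - P\<^sub>x B\<^sup>* L\<^sup>-\<^sup>1 B \<ell>(h,k) = \<Lambda> \<ell>(h,k)\<close> on \<open>T\<close>
  (lemma \<open>implicit_retraction_derivatives\<close>). By the chain rule
  \<open>D(J \<circ> F)(0) h = (grad J(x), h)\<close> and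
  \<open>D\<^sup>2(J \<circ> F)(0)(h,k) = (Hess J(x) h, k) + (grad J(x), \<Lambda> \<ell>(h,k))\<close>, and the last summand is the bilinear
  form that \<open>\<pi>\<close> represents. Symmetry of second derivatives makes the Hessian self-adjoint, and the
  second-order Taylor formula gives the two expansions.

  Two foundations carry this. The first is the Riesz representation theorem on closed subspaces of a
  real Hilbert space: it supplies adjoints, orthogonal projections, gradients, Hessians and
  \<open>\<pi>\<close>. The second is the identity \<open>T = T\<^sub>xM \<inter> ker B\<close> (lemma \<open>tangent_space_constraint_set\<close>), which
  shows in particular that \<open>T\<close>, defined through curves, is a closed subspace. Its hard inclusion
  requires a \<open>C\<^sup>1\<close> curve in the constraint set with prescribed velocity, which a contraction argument
  produces (lemma \<open>perturbed_line_C1\<close>).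
\<close>

section \<open>The Riesz representation theorem and orthogonal projections\<close>

lemma le_of_self_mult_le:
  fixes s t :: real
  assumes "s * s \<le> t * s" "0 \<le> t"
  shows "s \<le> t"
  using assms by (cases "s > 0") auto

text \<open>
  The representing vector minimizes \<open>q x = \<parallel>x\<parallel>\<^sup>2 - 2 \<phi> x\<close> over \<open>T\<close>. The parallelogram law makes
  minimizing sequences Cauchy, so a minimizer exists by completeness, and the first variation of
  \<open>q\<close> at the minimizer is the claimed identity. With \<open>\<phi> = (z, _)\<close> the same statement yields the
  orthogonal projection of \<open>z\<close>.
\<close>

lemma riesz_closed_subspace:
  fixes T :: "'a::{real_inner,banach} set" and \<phi> :: "'a \<Rightarrow> real"
  assumes T: "subspace T" "closed T" and \<phi>: "bounded_linear \<phi>"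
  shows "\<exists>g\<in>T. \<forall>v\<in>T. inner g v = \<phi> v"
proof -
  interpret \<phi>: bounded_linear \<phi> by (rule \<phi>)
  define q where "q x = inner x x - 2 * \<phi> x" for x
  obtain K where K: "\<And>x. norm (\<phi> x) \<le> norm x * K"
    using \<phi>.pos_bounded by blast
  have "- K\<^sup>2 \<le> q x" for x
  proof -
    have "0 \<le> (norm x - K)\<^sup>2" by simp
    then show ?thesis
      using K[of x] by (simp add: q_def power2_norm_eq_inner[symmetric] power2_eq_square algebra_simps)
  qed
  then have bdd: "bdd_below (q ` T)" by (rule bdd_belowI2)
  have "0 \<in> T" using T by (simp add: subspace_0)
  define m where "m = (INF x\<in>T. q x)"
  have m_le: "m \<le> q x" if "x \<in> T" for x
    unfolding m_def using bdd that by (rule cINF_lower)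
  have "\<exists>x\<in>T. q x < m + 1 / real (Suc n)" for n
    using \<open>0 \<in> T\<close> cInf_lessD[of "q ` T" "m + 1 / real (Suc n)"] unfolding m_def by auto
  then obtain X where X: "\<And>n. X n \<in> T" "\<And>n. q (X n) < m + 1 / real (Suc n)" by metis
  have par: "(norm (x - y))\<^sup>2 \<le> 2 * (q x - m) + 2 * (q y - m)" if "x \<in> T" "y \<in> T" for x y
  proof -
    have "m \<le> q ((1/2) *\<^sub>R (x + y))"
      using T that by (intro m_le subspace_scale subspace_add)
    then show ?thesis
      by (simp add: q_def power2_norm_eq_inner inner_simps \<phi>.scaleR \<phi>.add algebra_simps inner_commute)
  qed
  have "Cauchy X"
  proof (rule metric_CauchyI)
    fix e :: real assume "e > 0"
    then obtain N where N: "1 / real (Suc N) < e\<^sup>2 / 4"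
      using nat_approx_posE[of "e\<^sup>2 / 4"] by auto
    have "dist (X i) (X j) < e" if "i \<ge> N" "j \<ge> N" for i j
    proof -
      have "1 / real (Suc i) \<le> 1 / real (Suc N)" "1 / real (Suc j) \<le> 1 / real (Suc N)"
        using that by (auto simp: field_simps)
      then have "(norm (X i - X j))\<^sup>2 < e\<^sup>2"
        using par[OF X(1)[of i] X(1)[of j]] X(2)[of i] X(2)[of j] N
        by (simp del: of_nat_Suc)
      then show ?thesis
        using \<open>e > 0\<close> by (simp add: dist_norm power2_less_imp_less)
    qed
    then show "\<exists>N. \<forall>i\<ge>N. \<forall>j\<ge>N. dist (X i) (X j) < e" by blast
  qed
  then obtain g where g: "X \<longlonglongrightarrow> g"
    using Cauchy_convergent convergent_def by blast
  have "g \<in> T" using closed_sequentially[OF T(2)] X(1) g by blast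
  have "(\<lambda>n. q (X n)) \<longlonglongrightarrow> q g"
    unfolding q_def by (intro tendsto_intros \<phi>.tendsto g)
  moreover have "(\<lambda>n. m + 1 / real (Suc n)) \<longlonglongrightarrow> m + 0"
    using LIMSEQ_inverse_real_of_nat by (intro tendsto_intros) (simp add: inverse_eq_divide)
  ultimately have "q g \<le> m + 0"
    by (rule LIMSEQ_le) (use X(2) less_imp_le in blast)
  have "inner g v = \<phi> v" if "v \<in> T" for v
  proof -
    define d where "d = inner g v - \<phi> v"
    define s where "s = inner v v + 1"
    have s: "s > 0" by (simp add: s_def add_nonneg_pos)
    have expand: "q (g + t *\<^sub>R v) = q g + 2 * t * d + t\<^sup>2 * (s - 1)" for t
      by (simp add: q_def d_def s_def \<phi>.add \<phi>.scaleR inner_simps inner_commute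
          power2_eq_square algebra_simps)
    \<comment> \<open>The step \<open>- d / s\<close> makes the negative linear term dominate the quadratic one.\<close>
    have "m \<le> q (g + (- d / s) *\<^sub>R v)"
      using T \<open>g \<in> T\<close> that by (intro m_le subspace_add subspace_scale)
    also have "\<dots> = q g + 2 * (- d / s) * d + (- d / s)\<^sup>2 * (s - 1)"
      by (rule expand)
    finally have "0 \<le> 2 * (- d / s) * d + (- d / s)\<^sup>2 * (s - 1)"
      using \<open>q g \<le> m + 0\<close> by simp
    also have "\<dots> = - (d\<^sup>2 * (s + 1)) / s\<^sup>2"
      using s by (simp add: field_simps power2_eq_square)
    finally have "d\<^sup>2 * (s + 1) \<le> 0"
      using s by (simp add: divide_le_0_iff zero_le_divide_iff)
    then show ?thesis
      using s by (simp add: mult_le_0_iff d_def)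
  qed
  then show ?thesis using \<open>g \<in> T\<close> by blast
qed

definition riesz :: "('a::{real_inner,banach} \<Rightarrow>\<^sub>L real) \<Rightarrow> 'a" where
  "riesz \<phi> = (SOME g. \<forall>v. inner g v = \<phi> v)"

lemma inner_riesz [simp]: "inner (riesz \<phi>) v = blinfun_apply \<phi> v"
  unfolding riesz_def
  using someI_ex[of "\<lambda>g. \<forall>v. inner g v = blinfun_apply \<phi> v"]
    riesz_closed_subspace[of UNIV "blinfun_apply \<phi>"] blinfun.bounded_linear_right by auto

lemma inner_riesz_right [simp]: "inner v (riesz \<phi>) = blinfun_apply \<phi> v"
  using inner_riesz[of \<phi> v] by (simp only: inner_commute)

lemma bounded_linear_riesz: "bounded_linear (riesz :: ('a::{real_inner,banach} \<Rightarrow>\<^sub>L real) \<Rightarrow> 'a)"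
proof (rule bounded_linear_intro[where K=1])
  fix \<phi> \<psi> :: "'a \<Rightarrow>\<^sub>L real" and a :: real
  show "riesz (\<phi> + \<psi>) = riesz \<phi> + riesz \<psi>"
    by (rule vector_eq_rdot[THEN iffD1]) (simp add: inner_add_left plus_blinfun.rep_eq)
  show "riesz (a *\<^sub>R \<phi>) = a *\<^sub>R riesz \<phi>"
    by (rule vector_eq_rdot[THEN iffD1]) (simp add: scaleR_blinfun.rep_eq)
  have "norm (riesz \<phi>) * norm (riesz \<phi>) \<le> norm \<phi> * norm (riesz \<phi>)"
    using norm_blinfun[of \<phi> "riesz \<phi>"] inner_riesz[of \<phi> "riesz \<phi>"]
    by (simp add: power2_norm_eq_inner[symmetric] power2_eq_square)
  then have "norm (riesz \<phi>) \<le> norm \<phi>"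
    by (rule le_of_self_mult_le) auto
  then show "norm (riesz \<phi>) \<le> norm \<phi> * 1" by simp
qed

text \<open>
  The contraction bound says that balls around \<open>0\<close> are mapped into themselves; the implicit function is
  given on such a ball of \<open>T\<close>.
\<close>

definition orthogonal_projection :: "'a::real_inner set \<Rightarrow> ('a \<Rightarrow> 'a) \<Rightarrow> bool" where
  "orthogonal_projection T Q \<longleftrightarrow> subspace T \<and> bounded_linear Q \<and> (\<forall>z. Q z \<in> T) \<and>
     (\<forall>z\<in>T. Q z = z) \<and> (\<forall>z. \<forall>v\<in>T. inner (Q z) v = inner z v) \<and> (\<forall>z. norm (Q z) \<le> norm z)"

lemma orthogonal_projectionD:
  assumes "orthogonal_projection T Q"
  shows "subspace T" "bounded_linear Q" "\<And>z. Q z \<in> T" "\<And>z. z \<in> T \<Longrightarrow> Q z = z"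
    "\<And>z v. v \<in> T \<Longrightarrow> inner (Q z) v = inner z v" "\<And>z. norm (Q z) \<le> norm z"
  using assms by (auto simp: orthogonal_projection_def)

lemma orthogonal_projection_UNIV: "orthogonal_projection UNIV (\<lambda>z. z)"
  by (simp add: orthogonal_projection_def bounded_linear_ident)

lemma orthogonal_projection_self_adjoint:
  assumes "orthogonal_projection T Q"
  shows "inner (Q u) v = inner u (Q v)"
  using orthogonal_projectionD[OF assms] by (metis inner_commute)

lemma orthogonal_projection_exists:
  fixes T :: "'a::{real_inner,banach} set"
  assumes T: "subspace T" "closed T"
  obtains Q where "orthogonal_projection T Q"
proof -
  have "\<exists>g\<in>T. \<forall>v\<in>T. inner g v = inner z v" for z
    by (rule riesz_closed_subspace[OF T bounded_linear_inner_right])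
  then obtain Q where Q: "\<And>z. Q z \<in> T" "\<And>z v. v \<in> T \<Longrightarrow> inner (Q z) v = inner z v"
    by metis
  have eqI: "Q z = g" if "g \<in> T" "\<And>v. v \<in> T \<Longrightarrow> inner g v = inner z v" for z g
  proof -
    have "Q z - g \<in> T" using Q(1) that(1) T(1) by (simp add: subspace_diff)
    then have "inner (Q z - g) (Q z - g) = 0"
      using Q(2)[of "Q z - g" z] that(2)[of "Q z - g"] by (simp add: inner_diff_left)
    then show ?thesis by simp
  qed
  have nQ: "norm (Q z) \<le> norm z" for z
  proof -
    have "norm (Q z) * norm (Q z) = inner z (Q z)"
      using Q(2)[OF Q(1), of z z] by (simp add: power2_norm_eq_inner[symmetric] power2_eq_square)
    also have "\<dots> \<le> norm z * norm (Q z)" by (rule norm_cauchy_schwarz)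
    finally show ?thesis
      by (rule le_of_self_mult_le) auto
  qed
  have "bounded_linear Q"
  proof (rule bounded_linear_intro[where K=1])
    show "Q (z + w) = Q z + Q w" for z w
      using Q T by (intro eqI) (auto simp: subspace_add inner_add_left)
    show "Q (a *\<^sub>R z) = a *\<^sub>R Q z" for a z
      using Q T by (intro eqI) (auto simp: subspace_scale)
  qed (simp add: nQ)
  moreover have "Q z = z" if "z \<in> T" for z
    using that by (intro eqI) auto
  ultimately have "orthogonal_projection T Q"
    using Q nQ T(1) by (simp add: orthogonal_projection_def)
  then show thesis by (rule that)
qed

text \<open>
  The constant \<open>adjoint\<close> is a choice operator; the Riesz representation of \<open>x \<mapsto> (B x, y)\<close> shows that
  the choice is not vacuous.
\<close>

lemma
  fixes B :: "'a::{real_inner,banach} \<Rightarrow> 'b::real_inner"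
  assumes B: "bounded_linear B"
  shows inner_adjoint: "inner x (adjoint B y) = inner (B x) y"
    and bounded_linear_adjoint: "bounded_linear (adjoint B)"
proof -
  interpret bounded_linear B by (rule B)
  let ?\<phi> = "\<lambda>y. Blinfun (\<lambda>x. inner (B x) y)"
  have bl: "bounded_linear (\<lambda>x. inner (B x) y)" for y
    by (rule bounded_linear_compose[OF bounded_linear_inner_left B])
  have ex: "\<forall>x y. inner (B x) y = inner x (riesz (?\<phi> y))"
    by (simp add: bounded_linear_Blinfun_apply[OF bl])
  then have adj: "adjoint B = (\<lambda>y. riesz (?\<phi> y))"
    by (rule adjoint_unique)
  show 1: "inner x (adjoint B y) = inner (B x) y" for x y
    unfolding adj by (rule ex[rule_format, symmetric])
  obtain K where K: "0 \<le> K" "\<And>x. norm (B x) \<le> norm x * K" using nonneg_bounded by blast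
  show "bounded_linear (adjoint B)"
  proof (rule bounded_linear_intro[where K=K])
    show "adjoint B (y + z) = adjoint B y + adjoint B z" for y z
      by (rule vector_eq_ldot[THEN iffD1]) (simp add: 1 inner_add_right)
    show "adjoint B (a *\<^sub>R y) = a *\<^sub>R adjoint B y" for a y
      by (rule vector_eq_ldot[THEN iffD1]) (simp add: 1)
    show "norm (adjoint B y) \<le> norm y * K" for y
    proof -
      let ?g = "adjoint B y"
      have "norm ?g * norm ?g = inner (B ?g) y"
        using 1[of ?g y] by (simp add: power2_norm_eq_inner[symmetric] power2_eq_square)
      also have "\<dots> \<le> norm (B ?g) * norm y" by (rule norm_cauchy_schwarz)
      also have "\<dots> \<le> norm ?g * K * norm y" by (intro mult_right_mono K(2)) simp
      finally have "norm ?g * norm ?g \<le> (norm y * K) * norm ?g" by (simp add: mult_ac)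
      moreover have "0 \<le> norm y * K"
        using K(1) by simp
      ultimately show ?thesis
        by (rule le_of_self_mult_le)
    qed
  qed
qed

section \<open>Maps that are twice differentiable at a point\<close>

text \<open>
  Differentiability of \<open>f'\<close> at the single point \<open>a\<close> already gives the symmetry of the second
  derivative and the second-order Taylor formula at \<open>a\<close>, and it is preserved by composition without
  any bookkeeping for continuity of second derivatives.
\<close>

definition has_two_derivatives ::
  "'a::real_normed_vector set \<Rightarrow> 'a \<Rightarrow> ('a \<Rightarrow> 'b::real_normed_vector) \<Rightarrow>
    ('a \<Rightarrow> 'a \<Rightarrow>\<^sub>L 'b) \<Rightarrow> ('a \<Rightarrow> 'a \<Rightarrow>\<^sub>L 'b) \<Rightarrow> bool" where
  "has_two_derivatives S a f f' f'' \<longleftrightarrow> open S \<and> a \<in> S \<and>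
     (\<forall>x\<in>S. (f has_derivative blinfun_apply (f' x)) (at x)) \<and> (f' has_derivative f'') (at a)"

lemma has_two_derivativesD:
  assumes "has_two_derivatives S a f f' f''"
  shows "open S" "a \<in> S" "\<And>x. x \<in> S \<Longrightarrow> (f has_derivative blinfun_apply (f' x)) (at x)"
    "(f' has_derivative f'') (at a)" "bounded_linear f''"
  using assms has_derivative_bounded_linear by (auto simp: has_two_derivatives_def)

lemma has_two_derivatives_subset:
  assumes "has_two_derivatives S a f f' f''" "open U" "a \<in> U" "U \<subseteq> S"
  shows "has_two_derivatives U a f f' f''"
  using assms by (auto simp: has_two_derivatives_def)

lemma has_two_derivatives_linear:
  assumes "bounded_linear A"
  shows "has_two_derivatives UNIV a A (\<lambda>_. Blinfun A) (\<lambda>_. 0)"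
  using assms by (simp add: has_two_derivatives_def bounded_linear_Blinfun_apply
      bounded_linear_imp_has_derivative)

lemma has_two_derivatives_diff:
  assumes "has_two_derivatives S a f f' f''" "has_two_derivatives S a g g' g''"
  shows "has_two_derivatives S a (\<lambda>x. f x - g x) (\<lambda>x. f' x - g' x) (\<lambda>h. f'' h - g'' h)"
  using assms unfolding has_two_derivatives_def
  by (auto simp: minus_blinfun.rep_eq[abs_def] intro!: has_derivative_diff)

text \<open>
  Second-order chain rule: \<open>D\<^sup>2(g \<circ> f)(h,k) = D\<^sup>2g (Df h, Df k) + Dg (D\<^sup>2f (h,k))\<close>.
\<close>

lemma has_two_derivatives_compose:
  assumes f: "has_two_derivatives S a f f' f''" and g: "has_two_derivatives U (f a) g g' g''"
    and "f ` S \<subseteq> U"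
  shows "has_two_derivatives S a (\<lambda>x. g (f x)) (\<lambda>x. g' (f x) o\<^sub>L f' x)
    (\<lambda>h. (g'' (f' a h) o\<^sub>L f' a) + (g' (f a) o\<^sub>L f'' h))"
proof -
  note f = has_two_derivativesD[OF f] and g = has_two_derivativesD[OF g]
  have "((\<lambda>x. g (f x)) has_derivative blinfun_apply (g' (f x) o\<^sub>L f' x)) (at x)" if "x \<in> S" for x
  proof -
    have "f x \<in> U" using that assms(3) by blast
    then show ?thesis
      using has_derivative_compose[OF f(3)[OF that] g(3)[of "f x"]]
      by (simp add: blinfun_compose.rep_eq o_def)
  qed
  moreover have "((\<lambda>x. g' (f x) o\<^sub>L f' x) has_derivative
      (\<lambda>h. (g'' (f' a h) o\<^sub>L f' a) + (g' (f a) o\<^sub>L f'' h))) (at a)"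
    using bounded_bilinear.FDERIV[OF bounded_bilinear_blinfun_compose
        has_derivative_compose[OF f(3)[OF f(2)] g(4)] f(4)]
    by (simp add: add.commute)
  ultimately show ?thesis using f by (simp add: has_two_derivatives_def)
qed

lemma two_derivatives_of_constant:
  assumes f: "has_two_derivatives U a f f' f''" and c: "\<And>z. z \<in> U \<Longrightarrow> f z = c"
  shows "f' a h = 0" "f'' h k = 0"
proof -
  note f' = has_two_derivativesD[OF f]
  have zero: "f' z = 0" if "z \<in> U" for z
  proof -
    have "((\<lambda>_. c) has_derivative f' z) (at z)"
      by (rule has_derivative_transform_within_open[OF f'(3)[OF that] f'(1) that]) (use c in auto)
    then have "blinfun_apply (f' z) = (\<lambda>_. 0)" by (rule has_derivative_unique[OF _ has_derivative_const])
    then show ?thesis by (intro blinfun_eqI) simp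
  qed
  then show "f' a h = 0" using f'(2) by simp
  have "((\<lambda>_. 0) has_derivative f'') (at a)"
    by (rule has_derivative_transform_within_open[OF f'(4) f'(1,2)]) (use zero in auto)
  then have "f'' = (\<lambda>_. 0)" by (rule has_derivative_unique[OF _ has_derivative_const])
  then show "f'' h k = 0" by simp
qed

text \<open>
  Precomposition with a projection onto the subspace that contains \<open>S\<close> turns derivatives within \<open>S\<close>
  into derivatives on an open set.
\<close>

lemma C2_on_compose_linear:
  assumes "C2_on S f" "bounded_linear Q" "open U" "Q ` U \<subseteq> S" "a \<in> U"
  obtains f' f'' where "has_two_derivatives U a (\<lambda>x. f (Q x)) f' f''" "continuous_on U f'"
proof -
  obtain g' g'' where g: "\<And>x. x \<in> S \<Longrightarrow> (f has_derivative blinfun_apply (g' x)) (at x within S)"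
     "\<And>x. x \<in> S \<Longrightarrow> (g' has_derivative blinfun_apply (g'' x)) (at x within S)"
    using assms(1) unfolding C2_on_def by blast
  have Q: "(Q has_derivative Q) (at x within U)" for x
    using assms(2) by (rule bounded_linear_imp_has_derivative)
  have 1: "((\<lambda>x. f (Q x)) has_derivative blinfun_apply (g' (Q x) o\<^sub>L Blinfun Q)) (at x)" if "x \<in> U" for x
  proof -
    have "blinfun_apply (g' (Q x) o\<^sub>L Blinfun Q) = (\<lambda>h. g' (Q x) (Q h))"
      by (rule ext) (simp add: bounded_linear_Blinfun_apply[OF assms(2)])
    then show ?thesis
      using has_derivative_in_compose2[OF g(1) assms(4) that Q]
      unfolding at_within_open[OF that assms(3)] by simp
  qed
  have 2: "((\<lambda>x. g' (Q x) o\<^sub>L Blinfun Q) has_derivative (\<lambda>h. g'' (Q x) (Q h) o\<^sub>L Blinfun Q)) (at x)"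
    if "x \<in> U" for x
    using bounded_linear.has_derivative[OF bounded_bilinear.bounded_linear_left[OF bounded_bilinear_blinfun_compose]
      has_derivative_in_compose2[OF g(2) assms(4) that Q]]
    unfolding at_within_open[OF that assms(3)] .
  have "has_two_derivatives U a (\<lambda>x. f (Q x)) (\<lambda>x. g' (Q x) o\<^sub>L Blinfun Q) (\<lambda>h. g'' (Q a) (Q h) o\<^sub>L Blinfun Q)"
    using 1 2 assms by (simp add: has_two_derivatives_def)
  moreover have "continuous_on U (\<lambda>x. g' (Q x) o\<^sub>L Blinfun Q)"
    by (intro continuous_at_imp_continuous_on ballI has_derivative_continuous[OF 2])
  ultimately show thesis by (rule that)
qed

lemma has_two_derivatives_estimate:
  assumes "has_two_derivatives S a f f' f''" "e > 0"
  obtains d where "d > 0" "ball a d \<subseteq> S"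
    "\<And>y. y \<in> ball a d \<Longrightarrow> norm (f' y - f' a - f'' (y - a)) \<le> e * norm (y - a)"
proof -
  note f = has_two_derivativesD[OF assms(1)]
  obtain d1 where d1: "d1 > 0" "ball a d1 \<subseteq> S"
    using f by (meson openE)
  obtain d2 where d2: "d2 > 0" "\<And>y. norm (y - a) < d2 \<Longrightarrow> norm (f' y - f' a - f'' (y - a)) \<le> e * norm (y - a)"
    using f(4) assms(2) unfolding has_derivative_at_alt by blast
  show thesis
    by (rule that[of "min d1 d2"]) (use d1 d2 in \<open>auto simp: dist_norm norm_minus_commute\<close>)
qed

text \<open>
  The second difference of \<open>f\<close> in the directions \<open>h\<close> and \<open>k\<close> is the increment over \<open>[0, s]\<close> of
  \<open>\<tau> \<mapsto> f (a + s h + \<tau> k) - f (a + \<tau> k)\<close>. The derivative of this function is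
  \<open>(f' (a + s h + \<tau> k) - f' (a + \<tau> k)) k\<close>, which differs from \<open>s f'' h k\<close> by \<open>o(s)\<close> because \<open>f'\<close> is
  differentiable at \<open>a\<close>.
\<close>

lemma second_difference_estimate:
  assumes f: "has_two_derivatives S a f f' f''" and "e > 0"
  shows "\<exists>d>0. \<forall>s. 0 < s \<and> s < d \<longrightarrow>
    norm (f (a + s *\<^sub>R h + s *\<^sub>R k) - f (a + s *\<^sub>R h) - f (a + s *\<^sub>R k) + f a - s\<^sup>2 *\<^sub>R f'' h k)
      \<le> e * s\<^sup>2"
proof -
  \<comment> \<open>All displacements are at most \<open>s c\<close>. Two errors \<open>\<eta> s c\<close> of \<open>f'\<close>, applied to the vector \<open>k\<close> of norm at
    most \<open>c\<close>, have to add up to \<open>e s\<close>.\<close>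
  define c where "c = norm h + norm k + 1"
  have c: "c > 0" "norm h + norm k \<le> c" "norm k \<le> c" by (auto simp: c_def add_nonneg_pos)
  define \<eta> where "\<eta> = e / (2 * c * c)"
  have \<eta>: "\<eta> > 0" "2 * \<eta> * c * c = e" using c assms(2) by (auto simp: \<eta>_def)
  interpret f'': bounded_linear f'' using has_two_derivativesD(5)[OF f] .
  obtain d where d: "d > 0" "ball a d \<subseteq> S"
    and est: "\<And>y. y \<in> ball a d \<Longrightarrow> norm (f' y - f' a - f'' (y - a)) \<le> \<eta> * norm (y - a)"
    using has_two_derivatives_estimate[OF f \<eta>(1)] by metis
  have "norm (f (a + s *\<^sub>R h + s *\<^sub>R k) - f (a + s *\<^sub>R h) - f (a + s *\<^sub>R k) + f a - s\<^sup>2 *\<^sub>R f'' h k)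
      \<le> e * s\<^sup>2" if s: "0 < s" "s < d / c" for s
  proof -
    define \<phi> where "\<phi> \<tau> = f (a + s *\<^sub>R h + \<tau> *\<^sub>R k) - f (a + \<tau> *\<^sub>R k) - (\<tau> * s) *\<^sub>R f'' h k" for \<tau>
    define \<phi>' where "\<phi>' \<tau> = (f' (a + s *\<^sub>R h + \<tau> *\<^sub>R k) - f' (a + \<tau> *\<^sub>R k) - s *\<^sub>R f'' h) k" for \<tau>
    have small: "norm (s *\<^sub>R h + \<tau> *\<^sub>R k) \<le> s * c" "norm (\<tau> *\<^sub>R k) \<le> s * c" if "\<tau> \<in> {0..s}" for \<tau>
    proof -
      have "norm (s *\<^sub>R h + \<tau> *\<^sub>R k) \<le> s * norm h + \<tau> * norm k"
        using norm_triangle_ineq[of "s *\<^sub>R h" "\<tau> *\<^sub>R k"] that s by simp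
      also have "\<dots> \<le> s * norm h + s * norm k" using that by (intro add_left_mono mult_right_mono) auto
      also have "\<dots> \<le> s * c" using c(2) s by (simp add: distrib_left[symmetric])
      finally show "norm (s *\<^sub>R h + \<tau> *\<^sub>R k) \<le> s * c" .
      show "norm (\<tau> *\<^sub>R k) \<le> s * c"
        using that c(3) by (auto intro!: mult_mono)
    qed
    have sc: "s * c < d" using s(2) c(1) by (simp add: field_simps)
    have inb: "a + s *\<^sub>R h + \<tau> *\<^sub>R k \<in> ball a d" "a + \<tau> *\<^sub>R k \<in> ball a d" if "\<tau> \<in> {0..s}" for \<tau>
    proof -
      have "a + w \<in> ball a d" if "norm w \<le> s * c" for w
        using that sc by (simp add: dist_norm)
      then show "a + s *\<^sub>R h + \<tau> *\<^sub>R k \<in> ball a d" "a + \<tau> *\<^sub>R k \<in> ball a d"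
        using small[OF that] by (simp_all only: add.assoc)
    qed
    have der: "(\<phi> has_derivative (\<lambda>t. t *\<^sub>R \<phi>' \<tau>)) (at \<tau> within {0..s})" if "\<tau> \<in> {0..s}" for \<tau>
    proof -
      have 1: "((\<lambda>\<tau>. f (b + \<tau> *\<^sub>R k)) has_derivative (\<lambda>t. f' (b + \<tau> *\<^sub>R k) (t *\<^sub>R k))) (at \<tau> within {0..s})"
        if "b + \<tau> *\<^sub>R k \<in> S" for b
      proof (rule has_derivative_compose[where g=f and f="\<lambda>\<tau>. b + \<tau> *\<^sub>R k" and f'="\<lambda>t. t *\<^sub>R k"])
        show "((\<lambda>\<tau>. b + \<tau> *\<^sub>R k) has_derivative (\<lambda>t. t *\<^sub>R k)) (at \<tau> within {0..s})"
          by (auto intro!: derivative_eq_intros)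
      qed (rule has_two_derivativesD(3)[OF f that])
      have "(\<phi> has_derivative (\<lambda>t. f' (a + s *\<^sub>R h + \<tau> *\<^sub>R k) (t *\<^sub>R k) - f' (a + \<tau> *\<^sub>R k) (t *\<^sub>R k)
          - (t * s) *\<^sub>R f'' h k)) (at \<tau> within {0..s})"
        unfolding \<phi>_def using inb[OF that] d(2)
        by (intro has_derivative_diff 1) (auto intro!: derivative_eq_intros)
      moreover have "(\<lambda>t. f' (a + s *\<^sub>R h + \<tau> *\<^sub>R k) (t *\<^sub>R k) - f' (a + \<tau> *\<^sub>R k) (t *\<^sub>R k)
          - (t * s) *\<^sub>R f'' h k) = (\<lambda>t. t *\<^sub>R \<phi>' \<tau>)"
        by (simp add: \<phi>'_def blinfun.bilinear_simps scaleR_diff_right)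
      ultimately show ?thesis by simp
    qed
    have bound: "onorm (\<lambda>t. t *\<^sub>R \<phi>' \<tau>) \<le> e * s" if "\<tau> \<in> {0..s}" for \<tau>
    proof -
      have sum_eq: "f' (a + s *\<^sub>R h + \<tau> *\<^sub>R k) - f' (a + \<tau> *\<^sub>R k) - s *\<^sub>R f'' h =
          (f' (a + s *\<^sub>R h + \<tau> *\<^sub>R k) - f' a - f'' (s *\<^sub>R h + \<tau> *\<^sub>R k)) -
          (f' (a + \<tau> *\<^sub>R k) - f' a - f'' (\<tau> *\<^sub>R k))"
        by (simp add: f''.add f''.scaleR)
      have "norm (f' (a + s *\<^sub>R h + \<tau> *\<^sub>R k) - f' (a + \<tau> *\<^sub>R k) - s *\<^sub>R f'' h) \<le>
          \<eta> * norm (s *\<^sub>R h + \<tau> *\<^sub>R k) + \<eta> * norm (\<tau> *\<^sub>R k)"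
        unfolding sum_eq using est[OF inb(1)[OF that]] est[OF inb(2)[OF that]]
        by (intro order_trans[OF norm_triangle_ineq4 add_mono]) (simp_all add: add.assoc)
      also have "\<dots> \<le> \<eta> * (s * c) + \<eta> * (s * c)"
        using small[OF that] \<eta>(1) by (intro add_mono mult_left_mono) auto
      finally have "norm (\<phi>' \<tau>) \<le> (\<eta> * (s * c) + \<eta> * (s * c)) * c"
        unfolding \<phi>'_def using c s \<eta>(1) norm_blinfun
        by (meson dual_order.trans mult_mono norm_ge_zero)
      also have "\<dots> = e * s" using \<eta>(2) by (simp add: algebra_simps)
      finally show ?thesis
        by (intro onorm_le) (simp add: mult_left_mono mult.commute)
    qed
    have "norm (\<phi> s - \<phi> 0) \<le> (e * s) * norm (s - 0)"
      by (rule differentiable_bound[OF convex_closed_interval der bound]) (use s in auto)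
    then show ?thesis
      using s by (simp add: \<phi>_def power2_eq_square algebra_simps)
  qed
  then show ?thesis using c d by (intro exI[of _ "d / c"]) auto
qed

text \<open>
  The second difference is symmetric in \<open>h\<close> and \<open>k\<close>, and \<open>f'' h k\<close> is its limit after division
  by \<open>s\<^sup>2\<close>.
\<close>

lemma second_derivative_symmetric:
  assumes f: "has_two_derivatives S a f f' f''"
  shows "f'' h k = f'' k h"
proof -
  have "norm (f'' h k - f'' k h) \<le> 0 + e" if "e > 0" for e :: real
  proof -
    let ?D = "\<lambda>s h k. f (a + s *\<^sub>R h + s *\<^sub>R k) - f (a + s *\<^sub>R h) - f (a + s *\<^sub>R k) + f a"
    have "e / 2 > 0" using that by simp
    from second_difference_estimate[OF f this, of h k] second_difference_estimate[OF f this, of k h]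
    obtain d1 d2 where d: "d1 > 0" "d2 > 0"
      "\<And>s. 0 < s \<Longrightarrow> s < d1 \<Longrightarrow> norm (?D s h k - s\<^sup>2 *\<^sub>R f'' h k) \<le> e / 2 * s\<^sup>2"
      "\<And>s. 0 < s \<Longrightarrow> s < d2 \<Longrightarrow> norm (?D s k h - s\<^sup>2 *\<^sub>R f'' k h) \<le> e / 2 * s\<^sup>2" by metis
    define s where "s = min d1 d2 / 2"
    have s: "0 < s" "s < d1" "s < d2" using d(1,2) by (auto simp: s_def)
    have "s\<^sup>2 *\<^sub>R (f'' h k - f'' k h) =
        (?D s k h - s\<^sup>2 *\<^sub>R f'' k h) - (?D s h k - s\<^sup>2 *\<^sub>R f'' h k)"
      by (simp add: algebra_simps)
    also have "norm \<dots> \<le> e / 2 * s\<^sup>2 + e / 2 * s\<^sup>2"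
      by (rule order_trans[OF norm_triangle_ineq4 add_mono[OF d(4)[OF s(1,3)] d(3)[OF s(1,2)]]])
    finally have "s\<^sup>2 * norm (f'' h k - f'' k h) \<le> s\<^sup>2 * e" by (simp add: mult.commute)
    then show ?thesis using s by simp
  qed
  then have "norm (f'' h k - f'' k h) \<le> 0" by (rule field_le_epsilon)
  then show ?thesis by simp
qed

text \<open>
  The derivative of the remainder at \<open>w\<close> is \<open>f' (a + w) - f' a - f'' w\<close>, where the symmetry of \<open>f''\<close>
  was used to differentiate the quadratic term. It is \<open>o(\<parallel>w\<parallel>)\<close>, so the mean value inequality on the
  ball of radius \<open>\<parallel>v\<parallel>\<close> bounds the remainder by \<open>o(\<parallel>v\<parallel>\<^sup>2)\<close>.
\<close>

lemma second_order_taylor: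
  assumes f: "has_two_derivatives S a f f' f''"
  shows "(\<lambda>v. f (a + v) - (f a + f' a v + (1/2) *\<^sub>R f'' v v)) \<in> o[at 0](\<lambda>v. (norm v)\<^sup>2)"
proof (rule landau_o.smallI)
  fix e :: real assume "e > 0"
  interpret f'': bounded_linear f'' using has_two_derivativesD(5)[OF f] .
  obtain d where d: "d > 0" "ball a d \<subseteq> S"
    and est: "\<And>y. y \<in> ball a d \<Longrightarrow> norm (f' y - f' a - f'' (y - a)) \<le> e * norm (y - a)"
    using has_two_derivatives_estimate[OF f \<open>e > 0\<close>] by metis
  define \<phi> where "\<phi> v = f (a + v) - (f a + f' a v + (1/2) *\<^sub>R f'' v v)" for v
  have "norm (\<phi> v) \<le> e * norm ((norm v)\<^sup>2)" if v: "norm v < d" for v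
  proof -
    have inb: "a + w \<in> ball a d" if "w \<in> cball 0 (norm v)" for w
      using that v by (auto simp: dist_norm norm_minus_commute)
    have der: "(\<phi> has_derivative blinfun_apply (f' (a + w) - f' a - f'' w)) (at w within cball 0 (norm v))"
      if w: "w \<in> cball 0 (norm v)" for w
    proof -
      have "((\<lambda>v. f (a + v)) has_derivative (\<lambda>u. f' (a + w) u)) (at w within cball 0 (norm v))"
      proof (rule has_derivative_compose[where g=f and f="\<lambda>v. a + v" and f'="\<lambda>u. u"])
        show "((\<lambda>v. a + v) has_derivative (\<lambda>u. u)) (at w within cball 0 (norm v))"
          by (auto intro!: derivative_eq_intros)
        show "(f has_derivative blinfun_apply (f' (a + w))) (at (a + w))"
          using inb[OF w] d(2) by (intro has_two_derivativesD(3)[OF f]) blast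
      qed
      moreover have "((\<lambda>v. f'' v v) has_derivative (\<lambda>u. f'' w u + f'' u w)) (at w within cball 0 (norm v))"
        by (rule blinfun.FDERIV[OF f''.has_derivative has_derivative_ident]) simp_all
      ultimately have "(\<phi> has_derivative (\<lambda>u. f' (a + w) u - (0 + f' a u + (1/2) *\<^sub>R (f'' w u + f'' u w))))
          (at w within cball 0 (norm v))"
        unfolding \<phi>_def
        by (intro has_derivative_diff has_derivative_add has_derivative_const
            has_derivative_scaleR_right bounded_linear_imp_has_derivative[OF blinfun.bounded_linear_right])
      moreover have "(\<lambda>u. f' (a + w) u - (0 + f' a u + (1/2) *\<^sub>R (f'' w u + f'' u w))) =
          blinfun_apply (f' (a + w) - f' a - f'' w)"
        by (rule ext) (simp add: blinfun.diff_left second_derivative_symmetric[OF f, of _ w] scaleR_2[symmetric])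
      ultimately show ?thesis by simp
    qed
    have "onorm (blinfun_apply (f' (a + w) - f' a - f'' w)) \<le> e * norm v" if w: "w \<in> cball 0 (norm v)" for w
    proof -
      have "norm (f' (a + w) - f' a - f'' w) \<le> e * norm w" using est[OF inb[OF w]] by simp
      also have "\<dots> \<le> e * norm v" using w \<open>e > 0\<close> by simp
      finally show ?thesis by (simp add: norm_blinfun.rep_eq)
    qed
    from differentiable_bound[OF convex_cball der this, of v 0]
    have "norm (\<phi> v - \<phi> 0) \<le> e * norm v * norm (v - 0)" by simp
    then show ?thesis by (simp add: \<phi>_def power2_eq_square mult.assoc)
  qed
  then show "\<forall>\<^sub>F v in at 0. norm (f (a + v) - (f a + f' a v + (1/2) *\<^sub>R f'' v v)) \<le> e * norm ((norm v)\<^sup>2)"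
    unfolding \<phi>_def eventually_at using d(1) by (auto intro!: exI[of _ d])
qed

section \<open>Gradients and Hessians on subspaces\<close>

text \<open>
  A derivative within a subspace is determined along the lines through \<open>a\<close> in that subspace, although
  its values elsewhere are arbitrary. This makes the gradient and the Hessian on \<open>T\<close> well
  defined.
\<close>

lemma has_derivative_within_subspace_unique:
  assumes T: "subspace T" "a \<in> T" "v \<in> T"
    and A: "(f has_derivative A) (at a within T)" and A': "(f has_derivative A') (at a within T)"
  shows "A v = A' v"
proof -
  have line: "((\<lambda>t::real. a + t *\<^sub>R v) has_derivative (\<lambda>t. t *\<^sub>R v)) (at 0)"
    by (auto intro!: derivative_eq_intros)
  have sub: "range (\<lambda>t::real. a + t *\<^sub>R v) \<subseteq> T"
    using T by (auto intro: subspace_add subspace_scale)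
  have "((\<lambda>t::real. f (a + t *\<^sub>R v)) has_derivative (\<lambda>t. D (t *\<^sub>R v))) (at 0)"
    if "(f has_derivative D) (at a within T)" for D
    by (rule has_derivative_in_compose[OF line]) (use has_derivative_subset[OF that sub] in simp)
  then have "(\<lambda>t. A (t *\<^sub>R v)) = (\<lambda>t. A' (t *\<^sub>R v))"
    using A A' has_derivative_unique by blast
  from fun_cong[OF this, of 1] show ?thesis by simp
qed

lemma gradient_on_eqI:
  assumes T: "subspace T" "a \<in> T" and g: "g \<in> T" "(f has_derivative (\<lambda>h. inner h g)) (at a within T)"
  shows "gradient_on T f a = g"
  unfolding gradient_on_def
proof (rule the_equality)
  fix g' assume g': "g' \<in> T \<and> (f has_derivative (\<lambda>h. inner h g')) (at a within T)"
  have "g' - g \<in> T" using g g' T by (simp add: subspace_diff)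
  then have "inner (g' - g) g' = inner (g' - g) g"
    using has_derivative_within_subspace_unique[OF T _ _ g(2)] g' by blast
  then have "inner (g' - g) (g' - g) = 0" by (simp add: inner_diff_right)
  then show "g' = g" by simp
qed (use g in simp)

text \<open>
  On \<open>T\<close> the function \<open>F\<close> coincides with \<open>f \<circ> Q\<close>, whose derivative \<open>f' \<circ> Q\<close> is represented by a
  vector of \<open>T\<close>.
\<close>

lemma gradient_on_restriction:
  fixes f :: "'a::{real_inner,banach} \<Rightarrow> real"
  assumes Q: "orthogonal_projection T Q" and f: "has_two_derivatives S a f f' f''"
    and F: "\<And>z. z \<in> S \<Longrightarrow> z \<in> T \<Longrightarrow> F z = f z" and z: "z \<in> S" "z \<in> T"
  shows "gradient_on T F z = Q (riesz (f' z))"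
proof (rule gradient_on_eqI)
  note Q' = orthogonal_projectionD[OF Q]
  have "((\<lambda>y. f (Q y)) has_derivative (\<lambda>h. f' z (Q h))) (at z within T)"
    using has_derivative_compose[OF bounded_linear_imp_has_derivative[OF Q'(2)], where g=f and g'="f' z"]
      has_two_derivativesD(3)[OF f z(1)] z(2) Q'(4) by simp
  moreover have "(\<lambda>h. f' z (Q h)) = (\<lambda>h. inner h (Q (riesz (f' z))))"
    by (simp add: orthogonal_projection_self_adjoint[OF Q, symmetric])
  ultimately have der: "((\<lambda>y. f (Q y)) has_derivative (\<lambda>h. inner h (Q (riesz (f' z))))) (at z within T)"
    by simp
  obtain d where d: "d > 0" "ball z d \<subseteq> S" using has_two_derivativesD(1)[OF f] z(1) by (meson openE)
  show "(F has_derivative (\<lambda>h. inner h (Q (riesz (f' z))))) (at z within T)"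
    by (rule has_derivative_transform_within[OF der d(1) z(2)])
      (use d(2) F Q'(4) in \<open>auto simp: subset_eq dist_commute\<close>)
qed (use orthogonal_projectionD[OF Q] z in auto)

lemma hessian_on_restriction:
  fixes f :: "'a::{real_inner,banach} \<Rightarrow> real"
  assumes Q: "orthogonal_projection T Q" and f: "has_two_derivatives S a f f' f''"
    and F: "\<And>z. z \<in> S \<Longrightarrow> z \<in> T \<Longrightarrow> F z = f z" and a: "a \<in> T" and v: "v \<in> T"
  shows "hessian_on T F a v = Q (riesz (f'' v))"
proof -
  note Q' = orthogonal_projectionD[OF Q] and f' = has_two_derivativesD[OF f]
  have der: "((\<lambda>z. Q (riesz (f' z))) has_derivative (\<lambda>h. Q (riesz (f'' h)))) (at a within T)"
    by (rule bounded_linear.has_derivative[OF Q'(2) bounded_linear.has_derivative[OF bounded_linear_riesz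
        has_derivative_at_withinI[OF f'(4)]]])
  obtain d where d: "d > 0" "ball a d \<subseteq> S" using f'(1,2) by (meson openE)
  have "(gradient_on T F has_derivative (\<lambda>h. Q (riesz (f'' h)))) (at a within T)"
  proof (rule has_derivative_transform_within[OF der d(1) a])
    fix z assume "z \<in> T" "dist z a < d"
    then have "z \<in> S" using d(2) by (auto simp: dist_commute)
    then show "Q (riesz (f' z)) = gradient_on T F z"
      using gradient_on_restriction[OF Q f F _ \<open>z \<in> T\<close>] by simp
  qed
  moreover from this have "(gradient_on T F has_derivative hessian_on T F a) (at a within T)"
    unfolding hessian_on_def by (metis differentiableI frechet_derivative_works)
  ultimately show ?thesis
    using has_derivative_within_subspace_unique[OF Q'(1) a v] by blast
qed

text \<open>
  Along every curve in \<open>N\<close> with velocity \<open>v\<close> the chain rule gives the derivative \<open>A v\<close>, which is the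
  inner product of \<open>v\<close> with the tangential part of the ambient gradient. Uniqueness holds since every
  tangent vector is the velocity of some curve.
\<close>

lemma riemannian_gradient_restriction:
  fixes f :: "'a::{real_inner,banach} \<Rightarrow> real"
  assumes Q: "orthogonal_projection (tangent_space N x) Q"
    and f: "(f has_derivative blinfun_apply A) (at x)" and F: "\<And>z. z \<in> N \<Longrightarrow> F z = f z"
  shows "riemannian_gradient N F x = Q (riesz A)"
proof -
  note Q' = orthogonal_projectionD[OF Q]
  have der: "((\<lambda>t. F (\<gamma> t)) has_real_derivative A v) (at 0)" if \<gamma>: "C1_curve_in N x v \<gamma>" for v \<gamma>
  proof -
    obtain e where e: "e > 0" "\<gamma> ` {-e<..<e} \<subseteq> N" "\<gamma> 0 = x" and d: "(\<gamma> has_derivative (\<lambda>t. t *\<^sub>R v)) (at 0)"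
      using \<gamma> unfolding C1_curve_in_def has_vector_derivative_def by blast
    have "((\<lambda>t. f (\<gamma> t)) has_derivative (\<lambda>t. t * A v)) (at 0)"
      using has_derivative_compose[OF d, where g=f and g'=A] f e(3) by (simp add: blinfun.scaleR_right)
    then have "((\<lambda>t. F (\<gamma> t)) has_derivative (\<lambda>t. t * A v)) (at 0)"
      by (rule has_derivative_transform_within_open[of _ _ _ _ "{-e<..<e}"])
        (use e F in \<open>auto simp: image_subset_iff\<close>)
    then show ?thesis by (rule has_derivative_imp_has_field_derivative) simp
  qed
  have curve: "\<exists>\<gamma>. C1_curve_in N x v \<gamma>" if "v \<in> tangent_space N x" for v
    using that by (simp add: tangent_space_def)
  show ?thesis
    unfolding riemannian_gradient_def
  proof (rule the_equality)
    show "Q (riesz A) \<in> tangent_space N x \<and> (\<forall>v \<gamma>. C1_curve_in N x v \<gamma> \<longrightarrow>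
      ((\<lambda>t. F (\<gamma> t)) has_real_derivative inner (Q (riesz A)) v) (at 0))"
    proof (intro conjI allI impI Q'(3))
      fix v \<gamma> assume \<gamma>: "C1_curve_in N x v \<gamma>"
      then have "v \<in> tangent_space N x" by (auto simp: tangent_space_def)
      then show "((\<lambda>t. F (\<gamma> t)) has_real_derivative inner (Q (riesz A)) v) (at 0)"
        using der[OF \<gamma>] by (simp add: Q'(5))
    qed
  next
    fix g assume g: "g \<in> tangent_space N x \<and> (\<forall>v \<gamma>. C1_curve_in N x v \<gamma> \<longrightarrow>
      ((\<lambda>t. F (\<gamma> t)) has_real_derivative inner g v) (at 0))"
    define v where "v = g - Q (riesz A)"
    have v: "v \<in> tangent_space N x" unfolding v_def using g Q'(1,3) by (simp add: subspace_diff)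
    then obtain \<gamma> where \<gamma>: "C1_curve_in N x v \<gamma>" using curve by blast
    then have "inner g v = A v" using g der DERIV_unique by blast
    then have "inner v v = 0" using Q'(5)[OF v, of "riesz A"] by (simp add: v_def inner_diff_left)
    then show "g = Q (riesz A)" by (simp add: v_def)
  qed
qed

section \<open>The tangent space of the constraint set\<close>

text \<open>
  This is the invertibility of \<open>Id + A\<close> for small \<open>A\<close>, with the contraction principle in place of the
  Neumann series.
\<close>

lemma affine_contraction_solution:
  fixes A :: "'a::banach \<Rightarrow>\<^sub>L 'a"
  assumes "norm A \<le> 1/2"
  obtains u where "u + A u = v"
proof -
  have "\<exists>!u. v - A u = u"
  proof (rule banach_fix_type[of "1/2"])
    show "\<forall>x y. dist (v - A x) (v - A y) \<le> 1/2 * dist x y"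
    proof (intro allI)
      fix x y
      have "dist (v - A x) (v - A y) = norm (A (x - y))"
        by (simp add: dist_norm blinfun.diff_right norm_minus_commute)
      also have "\<dots> \<le> norm A * norm (x - y)" by (rule norm_blinfun)
      also have "\<dots> \<le> 1/2 * norm (x - y)" using assms by (intro mult_right_mono) auto
      finally show "dist (v - A x) (v - A y) \<le> 1/2 * dist x y" by (simp add: dist_norm)
    qed
  qed auto
  then show thesis using that by (metis diff_add_cancel)
qed

lemma has_vector_derivative_iff_estimate:
  "(w has_vector_derivative u) (at s) \<longleftrightarrow>
    (\<forall>e>0. \<exists>d>0. \<forall>t. \<bar>t - s\<bar> < d \<longrightarrow> norm (w t - w s - (t - s) *\<^sub>R u) \<le> e * \<bar>t - s\<bar>)"
  by (auto simp: has_vector_derivative_def has_derivative_at_alt bounded_linear_scaleR_left)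

text \<open>
  The map \<open>Id + \<eta>\<close> is tangent to the identity at \<open>0\<close>, so it has a local \<open>C\<^sup>1\<close> inverse; \<open>w\<close> is the
  image of the line \<open>t v\<close> under this inverse. On the line the inverse is constructed directly: near \<open>0\<close> the map \<open>\<eta>\<close> contracts with factor \<open>1/2\<close>, so \<open>w t\<close> is the fixed point of
  \<open>z \<mapsto> t v - \<eta> z\<close>, and \<open>w\<close> is Lipschitz. The derivative \<open>u s\<close> has to solve the linearized equation
  \<open>u + \<eta>' (w s) u = v\<close>. Each estimate in the proof is of the form \<open>X = a - b\<close> with
  \<open>\<parallel>b\<parallel> \<le> \<parallel>X\<parallel> / 2\<close>, whence \<open>\<parallel>X\<parallel> \<le> 2 \<parallel>a\<parallel>\<close>.
\<close>

lemma perturbed_line_C1: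
  fixes \<eta> :: "'a::banach \<Rightarrow> 'a"
  assumes der: "\<And>z. (\<eta> has_derivative blinfun_apply (\<eta>' z)) (at z)"
    and cont: "continuous_on UNIV \<eta>'" and [simp]: "\<eta> 0 = 0" "\<eta>' 0 = 0"
  obtains e w where "e > 0" "w C1_differentiable_on {-e<..<e}" "w 0 = 0"
    "(w has_vector_derivative v) (at 0)" "\<And>t. t \<in> {-e<..<e} \<Longrightarrow> w t + \<eta> (w t) = t *\<^sub>R v"
proof -
  have "isCont \<eta>' 0" using cont by (simp add: continuous_on_eq_continuous_at)
  then obtain d0 where d0: "d0 > 0" "\<And>z. norm z < d0 \<Longrightarrow> norm (\<eta>' z) < 1/2"
    unfolding continuous_at_eps_delta by (metis dist_0_norm dist_commute \<open>\<eta>' 0 = 0\<close> half_gt_zero_iff zero_less_one)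
  define d where "d = d0 / 2"
  have d: "d > 0" "\<And>z. norm z \<le> d \<Longrightarrow> norm (\<eta>' z) \<le> 1/2"
    using d0 by (auto simp: d_def intro: less_imp_le)
  have lip: "norm (\<eta> x - \<eta> y) \<le> 1/2 * norm (x - y)" if "norm x \<le> d" "norm y \<le> d" for x y
    by (rule differentiable_bound[of "cball 0 d" \<eta> "\<lambda>z. blinfun_apply (\<eta>' z)"])
      (use that d(2) in \<open>auto simp: norm_blinfun.rep_eq[symmetric] intro: has_derivative_at_withinI der\<close>)
  \<comment> \<open>The factor is chosen so that \<open>z \<mapsto> t v - \<eta> z\<close> maps the ball of radius \<open>d\<close> to itself for \<open>\<bar>t\<bar> < e\<close>;
    adding \<open>1\<close> to the norm avoids a case distinction for \<open>v = 0\<close>.\<close>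
  define e where "e = d / (2 * (norm v + 1))"
  have nv: "norm v + 1 > 0" by (simp add: add_nonneg_pos)
  have e: "e > 0" "e * norm v \<le> d / 2"
    using d(1) nv by (auto simp: e_def field_simps)
  have "\<exists>!z\<in>cball 0 d. t *\<^sub>R v - \<eta> z = z" if t: "t \<in> {-e<..<e}" for t
  proof (rule Banach_fix[where c="1/2"])
    show "complete (cball (0::'a) d)" "cball (0::'a) d \<noteq> {}"
      using d(1) by (auto simp: complete_eq_closed)
    show "(\<lambda>z. t *\<^sub>R v - \<eta> z) ` cball 0 d \<subseteq> cball 0 d"
    proof safe
      fix z :: 'a assume "z \<in> cball 0 d"
      then have z: "norm z \<le> d" by simp
      have "norm (t *\<^sub>R v - \<eta> z) \<le> \<bar>t\<bar> * norm v + norm (\<eta> z)"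
        using norm_triangle_ineq4[of "t *\<^sub>R v" "\<eta> z"] by simp
      also have "\<bar>t\<bar> * norm v \<le> e * norm v" using t by (intro mult_right_mono) auto
      also have "norm (\<eta> z) \<le> 1/2 * norm z" using lip[OF z, of 0] d(1) by simp
      finally show "t *\<^sub>R v - \<eta> z \<in> cball 0 d" using z e(2) by simp
    qed
    show "dist (t *\<^sub>R v - \<eta> x) (t *\<^sub>R v - \<eta> y) \<le> 1/2 * dist x y"
      if "x \<in> cball 0 d" "y \<in> cball 0 d" for x y
      using lip[of x y] that by (simp add: dist_norm norm_minus_commute)
  qed auto
  then have "\<forall>t\<in>{-e<..<e}. \<exists>z. norm z \<le> d \<and> t *\<^sub>R v - \<eta> z = z" by (metis mem_cball_0)
  then obtain w where w0: "\<forall>t\<in>{-e<..<e}. norm (w t) \<le> d \<and> t *\<^sub>R v - \<eta> (w t) = w t" by metis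
  then have w: "norm (w t) \<le> d" "w t = t *\<^sub>R v - \<eta> (w t)" if "t \<in> {-e<..<e}" for t
    using that by auto
  have absorb: "norm x \<le> 2 * norm a" if "x = a - b" "norm b \<le> 1/2 * norm x" for x a b :: 'a
    using norm_triangle_ineq4[of a b] that by simp
  have "w 0 = - \<eta> (w 0)" using w(2)[of 0] e(1) by simp
  then have "norm (w 0) = norm (\<eta> (w 0))" by (metis norm_minus_cancel)
  also have "\<dots> \<le> 1/2 * norm (w 0)" using lip[of "w 0" 0] w(1)[of 0] d(1) e(1) by simp
  finally have [simp]: "w 0 = 0" by simp
  have w_lip: "norm (w t - w s) \<le> 2 * \<bar>t - s\<bar> * norm v" if "t \<in> {-e<..<e}" "s \<in> {-e<..<e}" for t s
  proof -
    have "w t - w s = (t - s) *\<^sub>R v - (\<eta> (w t) - \<eta> (w s))"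
      using w(2)[OF that(1)] w(2)[OF that(2)] by (simp add: algebra_simps)
    from absorb[OF this] show ?thesis using lip w(1) that by (simp add: mult.assoc)
  qed
  have w_cont: "continuous_on {-e<..<e} w"
  proof (rule lipschitz_on_continuous_on[of "2 * norm v"], rule lipschitz_onI)
    show "dist (w t) (w s) \<le> 2 * norm v * dist t s" if "t \<in> {-e<..<e}" "s \<in> {-e<..<e}" for t s
      using w_lip[OF that] by (simp add: dist_norm mult_ac)
  qed simp
  have "\<forall>t\<in>{-e<..<e}. \<exists>u. u + \<eta>' (w t) u = v"
    using affine_contraction_solution d(2) w(1) by metis
  then obtain u where u0: "\<forall>t\<in>{-e<..<e}. u t + \<eta>' (w t) (u t) = v" by metis
  then have u: "u t = v - \<eta>' (w t) (u t)" if "t \<in> {-e<..<e}" for t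
    using that by (metis add_diff_cancel_right')
  have half: "norm (\<eta>' (w t) x) \<le> 1/2 * norm x" if "t \<in> {-e<..<e}" for t x
    using norm_blinfun[of "\<eta>' (w t)" x] mult_right_mono[OF d(2)[OF w(1)[OF that]], of "norm x"] by simp
  have w_der: "(w has_vector_derivative u s) (at s)" if s: "s \<in> {-e<..<e}" for s
    unfolding has_vector_derivative_iff_estimate
  proof (intro allI impI)
    fix \<epsilon> :: real assume "\<epsilon> > 0"
    define \<kappa> where "\<kappa> = \<epsilon> / (4 * (norm v + 1))"
    have \<kappa>: "\<kappa> > 0" "4 * \<kappa> * norm v \<le> \<epsilon>"
      using \<open>\<epsilon> > 0\<close> nv by (auto simp: \<kappa>_def field_simps)
    obtain d1 where d1: "d1 > 0"
      "\<And>y. norm (y - w s) < d1 \<Longrightarrow> norm (\<eta> y - \<eta> (w s) - \<eta>' (w s) (y - w s)) \<le> \<kappa> * norm (y - w s)"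
      using der[of "w s"] \<kappa>(1) unfolding has_derivative_at_alt by blast
    obtain d2 where d2: "d2 > 0" "ball s d2 \<subseteq> {-e<..<e}"
      using s by (meson openE open_greaterThanLessThan)
    define d3 where "d3 = min d2 (d1 / (2 * (norm v + 1)))"
    have "d3 > 0" using d1(1) d2(1) nv by (simp add: d3_def)
    moreover have "norm (w t - w s - (t - s) *\<^sub>R u s) \<le> \<epsilon> * \<bar>t - s\<bar>" if t: "\<bar>t - s\<bar> < d3" for t
    proof -
      have "t \<in> ball s d2" using t by (simp add: d3_def dist_real_def abs_minus_commute)
      then have te: "t \<in> {-e<..<e}" using d2(2) by blast
      have "2 * \<bar>t - s\<bar> * norm v \<le> 2 * \<bar>t - s\<bar> * (norm v + 1)" by (intro mult_left_mono) auto
      also have "\<dots> < d1" using t nv by (simp add: d3_def field_simps)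
      finally have near: "norm (w t - w s) < d1" using w_lip[OF te s] by simp
      let ?r = "\<eta> (w t) - \<eta> (w s) - \<eta>' (w s) (w t - w s)"
      let ?x = "w t - w s - (t - s) *\<^sub>R u s"
      have "?x = (- ?r) - \<eta>' (w s) ?x"
      proof -
        have "w t - w s = (t - s) *\<^sub>R v - (\<eta> (w t) - \<eta> (w s))"
          using w(2)[OF te] w(2)[OF s] by (simp add: algebra_simps)
        moreover have "(t - s) *\<^sub>R u s = (t - s) *\<^sub>R v - (t - s) *\<^sub>R \<eta>' (w s) (u s)"
          using arg_cong[OF u[OF s], of "\<lambda>y. (t - s) *\<^sub>R y"] by (simp only: scaleR_diff_right)
        ultimately have x: "?x = (t - s) *\<^sub>R \<eta>' (w s) (u s) - (\<eta> (w t) - \<eta> (w s))"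
          by (simp only:) simp
        have "\<eta>' (w s) ?x = \<eta>' (w s) (w t - w s) - (t - s) *\<^sub>R \<eta>' (w s) (u s)"
          by (simp add: blinfun.diff_right blinfun.scaleR_right)
        then have "(- ?r) - \<eta>' (w s) ?x = (t - s) *\<^sub>R \<eta>' (w s) (u s) - (\<eta> (w t) - \<eta> (w s))" by simp
        then show ?thesis using x by metis
      qed
      from absorb[OF this half[OF s]] have "norm ?x \<le> 2 * norm ?r" by (simp only: norm_minus_cancel)
      also have "\<dots> \<le> 2 * (\<kappa> * norm (w t - w s))" using d1(2)[OF near] by simp
      also have "\<dots> \<le> 2 * (\<kappa> * (2 * \<bar>t - s\<bar> * norm v))" using w_lip[OF te s] \<kappa>(1)
        by (intro mult_left_mono) auto
      also have "\<dots> = (4 * \<kappa> * norm v) * \<bar>t - s\<bar>" by simp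
      also have "\<dots> \<le> \<epsilon> * \<bar>t - s\<bar>" using \<kappa>(2) by (intro mult_right_mono) auto
      finally show ?thesis .
    qed
    ultimately show "\<exists>d>0. \<forall>t. \<bar>t - s\<bar> < d \<longrightarrow> norm (w t - w s - (t - s) *\<^sub>R u s) \<le> \<epsilon> * \<bar>t - s\<bar>" by blast
  qed
  have "continuous_on {-e<..<e} u"
    unfolding continuous_on_def
  proof
    fix s assume s: "s \<in> {-e<..<e}"
    have "continuous_on {-e<..<e} (\<lambda>t. \<eta>' (w t))"
      by (rule continuous_on_compose2[OF cont w_cont]) simp
    then have "((\<lambda>t. \<eta>' (w t)) \<longlongrightarrow> \<eta>' (w s)) (at s within {-e<..<e})"
      using s by (simp add: continuous_on_def)
    then have lim: "((\<lambda>t. 2 * norm (\<eta>' (w t) (u s) - \<eta>' (w s) (u s))) \<longlongrightarrow> 2 * norm (\<eta>' (w s) (u s) - \<eta>' (w s) (u s)))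
        (at s within {-e<..<e})"
      by (intro tendsto_intros)
    have bound: "norm (u t - u s) \<le> 2 * norm (\<eta>' (w t) (u s) - \<eta>' (w s) (u s))" if t: "t \<in> {-e<..<e}" for t
    proof -
      have "u t - u s = - (\<eta>' (w t) (u s) - \<eta>' (w s) (u s)) - \<eta>' (w t) (u t - u s)"
        using u[OF t] u[OF s] by (simp add: blinfun.diff_right algebra_simps)
      from absorb[OF this half[OF t]] show ?thesis by (simp only: norm_minus_cancel)
    qed
    have "((\<lambda>t. u t - u s) \<longlongrightarrow> 0) (at s within {-e<..<e})"
      by (rule Lim_null_comparison[OF _ lim[simplified]])
        (use bound in \<open>auto simp: eventually_at_filter\<close>)
    then show "(u \<longlongrightarrow> u s) (at s within {-e<..<e})" by (simp add: LIM_zero_iff)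
  qed
  with w_der have "w C1_differentiable_on {-e<..<e}"
    unfolding C1_differentiable_on_def by blast
  moreover have "u 0 = v" using u0 e(1) by force
  ultimately show thesis
    using that[OF e(1)] w_der[of 0] e(1) w0 by (metis \<open>w 0 = 0\<close> add_diff_cancel_right' diff_add_cancel greaterThanLessThan_iff neg_less_0_iff_less)
qed

text \<open>
  The range of a bounded projection is the set of its fixed points, hence closed.
\<close>

lemma closed_subspace_projection_range:
  assumes "bounded_projection_onto T P"
  shows "subspace T" "closed T" "\<And>v. v \<in> T \<Longrightarrow> P v = v" "\<And>v. P v \<in> T"
proof -
  have P: "bounded_linear P" "T = range P" "\<And>v. P (P v) = P v"
    using assms by (auto simp: bounded_projection_onto_def o_def fun_eq_iff)
  show fix_T: "P v = v" if "v \<in> T" for v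
    using that P(2,3) by (metis imageE)
  show in_T: "P v \<in> T" for v using P(2) by blast
  show "subspace T" unfolding P(2) using P(1) by (simp add: bounded_linear.linear linear_subspace_image)
  have "T = {v. P v = v}" by (auto simp: fix_T) (metis in_T)
  then show "closed T"
    using closed_Collect_eq[of P "\<lambda>v. v"] P(1) by (simp add: linear_continuous_on continuous_on_id)
qed

text \<open>
  Extending the retraction by \<open>P\<close> turns \<open>DR(0) = Id\<close> on the tangent space into
  \<open>D(R \<circ> P)(0) = P\<close> on the whole space.
\<close>

lemma retraction_derivatives:
  assumes P: "bounded_projection_onto (tangent_space M x) P" and R: "C2_retraction_at M x \<rho>"
  obtains \<rho>' \<rho>'' where "has_two_derivatives UNIV 0 (\<lambda>z. \<rho> (P z)) \<rho>' \<rho>''"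
    "continuous_on UNIV \<rho>'" "\<And>z. \<rho>' 0 z = P z"
proof -
  define T where "T = tangent_space M x"
  have bl: "bounded_linear P" and rP: "range P = T"
    using P by (auto simp: bounded_projection_onto_def T_def)
  have \<rho>: "C2_on T \<rho>" "(\<rho> has_derivative (\<lambda>v. v)) (at 0 within T)"
    using R by (auto simp: C2_retraction_at_def T_def)
  obtain \<rho>' \<rho>'' where jet: "has_two_derivatives UNIV 0 (\<lambda>z. \<rho> (P z)) \<rho>' \<rho>''"
    and cont: "continuous_on UNIV \<rho>'"
    using C2_on_compose_linear[OF \<rho>(1) bl open_UNIV, of 0] rP by auto
  have "((\<lambda>z. \<rho> (P z)) has_derivative (\<lambda>z. P z)) (at 0)"
    using has_derivative_in_compose[of P P 0 UNIV \<rho> "\<lambda>v. v"] \<rho>(2) rP bl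
    by (simp add: bounded_linear.linear linear_0 bounded_linear_imp_has_derivative)
  then have "\<rho>' 0 z = P z" for z
    using has_derivative_unique[OF _ has_two_derivativesD(3)[OF jet UNIV_I]] by metis
  with jet cont show thesis by (rule that)
qed

lemma C1_curve_in_mono:
  assumes "C1_curve_in N x v \<gamma>" "N \<subseteq> N'"
  shows "C1_curve_in N' x v \<gamma>"
  using assms unfolding C1_curve_in_def by blast

text \<open>
  The inclusion from left to right differentiates \<open>B (\<gamma> t) = c\<close>. For the other one, let \<open>v\<close> be a
  tangent vector of \<open>M\<close> with \<open>B v = 0\<close>, and put \<open>K = B\<^sup>* L\<^sup>-\<^sup>1\<close>, a right inverse of \<open>B P\<close>. The
  perturbation \<open>\<eta> z = K (B (\<rho> (P z)) - c - B (P z))\<close> vanishes to first order at \<open>0\<close>, so there is a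
  \<open>C\<^sup>1\<close> curve \<open>w\<close> with \<open>w t + \<eta> (w t) = t v\<close> and velocity \<open>v\<close> at \<open>0\<close>. Applying \<open>B P\<close> to this
  equation leaves \<open>B (\<rho> (P (w t))) - c = t (B (P v)) = t (B v) = 0\<close>. Hence \<open>t \<mapsto> \<rho> (P (w t))\<close> is a
  curve in the constraint set, with velocity \<open>P v = v\<close>.
\<close>

lemma tangent_space_constraint_set:
  fixes B :: "'e::{real_inner,banach} \<Rightarrow> 'y::{real_inner,banach}"
  assumes B: "bounded_linear B" and P: "bounded_projection_onto (tangent_space M x) P"
    and R: "C2_retraction_at M x \<rho>"
    and L: "invertible_operator (\<lambda>y. B (P (adjoint B y)))" and x: "B x = c"
  shows "tangent_space (constraint_set M B c) x = {v \<in> tangent_space M x. B v = 0}"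
proof (intro subset_antisym subsetI)
  fix v assume "v \<in> tangent_space (constraint_set M B c) x"
  then obtain \<gamma> where \<gamma>: "C1_curve_in (constraint_set M B c) x v \<gamma>"
    unfolding tangent_space_def by blast
  then have "v \<in> tangent_space M x"
    using C1_curve_in_mono[OF \<gamma>] by (auto simp: tangent_space_def constraint_set_def)
  moreover have "B v = 0"
  proof -
    obtain e where e: "e > 0" "\<gamma> ` {-e<..<e} \<subseteq> constraint_set M B c"
      and d: "(\<gamma> has_vector_derivative v) (at 0)"
      using \<gamma> unfolding C1_curve_in_def by blast
    have on_c: "B (\<gamma> t) = c" if "t \<in> {-e<..<e}" for t
    proof -
      have "\<gamma> t \<in> constraint_set M B c" using e(2) that by blast
      then show ?thesis by (simp add: constraint_set_def)
    qed
    have "((\<lambda>t. B (\<gamma> t)) has_vector_derivative B v) (at 0)"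
      by (rule bounded_linear.has_vector_derivative[OF B d])
    then have "((\<lambda>t. c) has_vector_derivative B v) (at 0)"
      by (rule has_vector_derivative_transform_within_open[of _ _ _ "{-e<..<e}"])
        (use e(1) on_c in auto)
    then show ?thesis
      using vector_derivative_at has_vector_derivative_const by (metis vector_derivative_unique_at)
  qed
  ultimately show "v \<in> {v \<in> tangent_space M x. B v = 0}" by simp
next
  fix v assume "v \<in> {v \<in> tangent_space M x. B v = 0}"
  then have v: "v \<in> tangent_space M x" "B v = 0" by auto
  interpret B: bounded_linear B by (rule B)
  have bl: "bounded_linear P" using P by (simp add: bounded_projection_onto_def)
  interpret P: bounded_linear P by (rule bl)
  note P_in = closed_subspace_projection_range(4)[OF P]
  have Pv: "P v = v" by (rule closed_subspace_projection_range(3)[OF P v(1)])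
  have \<rho>: "\<rho> ` tangent_space M x \<subseteq> M" "\<rho> 0 = x"
    using R by (auto simp: C2_retraction_at_def)
  obtain \<rho>' \<rho>'' where jet: "has_two_derivatives UNIV 0 (\<lambda>z. \<rho> (P z)) \<rho>' \<rho>''"
    and cont: "continuous_on UNIV \<rho>'" and \<rho>'0: "\<And>z. \<rho>' 0 z = P z"
    using retraction_derivatives[OF P R] by blast
  note \<rho>'_der = has_two_derivativesD(3)[OF jet UNIV_I]
  let ?L = "\<lambda>y. B (P (adjoint B y))"
  define K where "K z = adjoint B (inv ?L z)" for z
  have K: "bounded_linear K"
    unfolding K_def using L
    by (intro bounded_linear_compose[OF bounded_linear_adjoint[OF B]]) (simp add: invertible_operator_def)
  then interpret K: bounded_linear K .
  have BPK: "B (P (K z)) = z" for z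
    using L unfolding K_def invertible_operator_def
    by (simp add: bij_is_surj surj_f_inv_f[of ?L])
  define \<eta> where "\<eta> z = K (B (\<rho> (P z)) - c - B (P z))" for z
  define \<eta>' where "\<eta>' z = Blinfun K o\<^sub>L Blinfun B o\<^sub>L (\<rho>' z - Blinfun P)" for z
  have app: "blinfun_apply (Blinfun K) = K" "blinfun_apply (Blinfun B) = B" "blinfun_apply (Blinfun P) = P"
    by (simp_all add: bounded_linear_Blinfun_apply K B bl)
  have "(\<eta> has_derivative blinfun_apply (\<eta>' z)) (at z)" for z
  proof -
    have "(\<eta> has_derivative (\<lambda>h. K (B (\<rho>' z h) - 0 - B (P h)))) (at z)"
      unfolding \<eta>_def
      by (intro K.has_derivative has_derivative_diff B.has_derivative \<rho>'_der has_derivative_const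
          P.has_derivative has_derivative_ident)
    then show ?thesis
      by (simp add: \<eta>'_def app blinfun_compose.rep_eq minus_blinfun.rep_eq o_def B.diff)
  qed
  moreover have "continuous_on UNIV \<eta>'"
    unfolding \<eta>'_def by (intro continuous_intros cont)
  moreover have "\<eta> 0 = 0" by (simp add: \<eta>_def P.zero \<rho>(2) x B.zero K.zero)
  moreover have "\<eta>' 0 = 0" 
    by (rule blinfun_eqI) (simp add: \<eta>'_def app \<rho>'0 blinfun.diff_left B.zero K.zero)
  ultimately obtain e w where e: "e > 0" "w C1_differentiable_on {-e<..<e}" "w 0 = 0"
    "(w has_vector_derivative v) (at 0)" "\<And>t. t \<in> {-e<..<e} \<Longrightarrow> w t + \<eta> (w t) = t *\<^sub>R v"
    using perturbed_line_C1[where \<eta>=\<eta> and \<eta>'=\<eta>' and v=v] by metis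
  define \<gamma> where "\<gamma> t = \<rho> (P (w t))" for t
  have der: "(\<gamma> has_vector_derivative \<rho>' (w t) u) (at t)" if "(w has_vector_derivative u) (at t)" for t u
    using has_derivative_compose[OF that[unfolded has_vector_derivative_def] \<rho>'_der]
    by (simp add: has_vector_derivative_def \<gamma>_def[abs_def] blinfun.scaleR_right)
  have "\<gamma> C1_differentiable_on {-e<..<e}"
  proof -
    obtain D where D: "\<And>t. t \<in> {-e<..<e} \<Longrightarrow> (w has_vector_derivative D t) (at t)" "continuous_on {-e<..<e} D"
      using e(2) unfolding C1_differentiable_on_def by blast
    have "continuous_on {-e<..<e} w"
      using D(1) by (meson continuous_at_imp_continuous_on has_vector_derivative_continuous)
    then have "continuous_on {-e<..<e} (\<lambda>t. \<rho>' (w t) (D t))"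
      by (intro blinfun.continuous_on D(2) continuous_on_compose2[OF cont]) auto
    with der[OF D(1)] show ?thesis unfolding C1_differentiable_on_def
      by (intro exI[of _ "\<lambda>t. \<rho>' (w t) (D t)"]) simp
  qed
  moreover have "\<gamma> t \<in> constraint_set M B c" if t: "t \<in> {-e<..<e}" for t
  proof -
    have "B (P (w t)) + B (P (\<eta> (w t))) = 0"
      using arg_cong[OF e(5)[OF t], of "\<lambda>z. B (P z)"] by (simp add: P.add B.add P.scaleR B.scaleR Pv v(2))
    then have "B (\<gamma> t) = c" by (simp add: \<eta>_def BPK \<gamma>_def)
    moreover have "\<gamma> t \<in> M" using \<rho>(1) P_in unfolding \<gamma>_def by blast
    ultimately show ?thesis by (simp add: constraint_set_def)
  qed
  moreover have "\<gamma> 0 = x" by (simp add: \<gamma>_def e(3) P.zero \<rho>(2))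
  moreover have "(\<gamma> has_vector_derivative v) (at 0)"
    using der[OF e(4)] by (simp add: e(3) \<rho>'0 Pv)
  ultimately have "C1_curve_in (constraint_set M B c) x v \<gamma>"
    unfolding C1_curve_in_def using e(1) by blast
  then show "v \<in> tangent_space (constraint_set M B c) x" by (auto simp: tangent_space_def)
qed

section \<open>Second derivatives of the retractions\<close>

text \<open>
  Both derivatives of \<open>B \<circ> F\<close> vanish because \<open>B \<circ> F\<close> is constant. With \<open>B Q = 0\<close> and \<open>L = B P A\<close>
  injective, the first one forces \<open>\<delta>' 0 = 0\<close>. The second one then reads
  \<open>B (\<rho>'' (Q h) (Q k)) = L (\<delta>'' h k)\<close> and determines \<open>\<delta>''\<close>. In the application \<open>A\<close> is the adjoint of
  \<open>B\<close>.
\<close>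

lemma implicit_retraction_derivatives:
  fixes B :: "'e::real_normed_vector \<Rightarrow> 'y::real_normed_vector"
  assumes bl: "bounded_linear B" "bounded_linear P" "bounded_linear A" "bounded_linear Q"
    and PQ: "\<And>z. P (Q z) = Q z" and BQ: "\<And>z. B (Q z) = 0"
    and L: "inj (\<lambda>y. B (P (A y)))"
    and \<rho>: "has_two_derivatives UNIV 0 \<rho> \<rho>' \<rho>''" "\<And>z. \<rho>' 0 z = P z"
    and \<delta>: "has_two_derivatives U 0 \<delta> \<delta>' \<delta>''" "\<delta> 0 = 0"
    and constr: "\<And>\<xi>. \<xi> \<in> U \<Longrightarrow> B (\<rho> (Q \<xi> - A (\<delta> \<xi>))) = c"
  obtains F' F'' where "has_two_derivatives U 0 (\<lambda>\<xi>. \<rho> (Q \<xi> - A (\<delta> \<xi>))) F' F''"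
    "\<And>h. F' 0 h = Q h"
    "\<And>h k. F'' h k = \<rho>'' (Q h) (Q k) - P (A (inv (\<lambda>y. B (P (A y))) (B (\<rho>'' (Q h) (Q k)))))"
proof -
  interpret B: bounded_linear B by (rule bl)
  interpret P: bounded_linear P by (rule bl)
  interpret A: bounded_linear A by (rule bl)
  interpret Q: bounded_linear Q by (rule bl)
  note app = bl[THEN bounded_linear_Blinfun_apply]
  note U = has_two_derivativesD(1,2)[OF \<delta>(1)]
  let ?L = "\<lambda>y. B (P (A y))"
  let ?k' = "\<lambda>\<xi>. Blinfun Q - (Blinfun A o\<^sub>L \<delta>' \<xi>)"
  let ?k'' = "\<lambda>h. - (Blinfun A o\<^sub>L \<delta>'' h)"
  have lin: "has_two_derivatives U 0 Q (\<lambda>_. Blinfun Q) (\<lambda>_. 0)"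
    by (rule has_two_derivatives_subset[OF has_two_derivatives_linear[OF bl(4)] U(1,2)]) simp
  have linA: "has_two_derivatives UNIV z A (\<lambda>_. Blinfun A) (\<lambda>_. 0)" for z
    using has_two_derivatives_linear[OF bl(3)] by (simp add: has_two_derivatives_def)
  have k: "has_two_derivatives U 0 (\<lambda>\<xi>. Q \<xi> - A (\<delta> \<xi>)) ?k' ?k''"
    using has_two_derivatives_diff[OF lin has_two_derivatives_compose[OF \<delta>(1) linA]] by simp
  let ?F' = "\<lambda>\<xi>. \<rho>' (Q \<xi> - A (\<delta> \<xi>)) o\<^sub>L ?k' \<xi>"
  let ?F'' = "\<lambda>h. (\<rho>'' (?k' 0 h) o\<^sub>L ?k' 0) + (\<rho>' 0 o\<^sub>L ?k'' h)"
  have F: "has_two_derivatives U 0 (\<lambda>\<xi>. \<rho> (Q \<xi> - A (\<delta> \<xi>))) ?F' ?F''"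
    using has_two_derivatives_compose[OF k, of UNIV \<rho> \<rho>' \<rho>''] \<rho>(1)
    by (simp add: \<delta>(2) Q.zero A.zero)
  have linB: "has_two_derivatives UNIV z B (\<lambda>_. Blinfun B) (\<lambda>_. 0)" for z
    using has_two_derivatives_linear[OF bl(1)] by (simp add: has_two_derivatives_def)
  have BF: "has_two_derivatives U 0 (\<lambda>\<xi>. B (\<rho> (Q \<xi> - A (\<delta> \<xi>)))) (\<lambda>\<xi>. Blinfun B o\<^sub>L ?F' \<xi>)
      (\<lambda>h. Blinfun B o\<^sub>L ?F'' h)"
    using has_two_derivatives_compose[OF F linB] by simp
  have BF0: "B (?F' 0 h) = 0" "B (?F'' h k) = 0" for h k
    using two_derivatives_of_constant(1)[OF BF constr, of h] two_derivatives_of_constant(2)[OF BF constr, of h k]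
    by (simp_all add: app)
  have \<delta>'0: "\<delta>' 0 h = 0" for h
  proof -
    have "?L (\<delta>' 0 h) = ?L 0"
      using BF0(1)[of h]
      by (simp add: \<delta>(2) Q.zero A.zero \<rho>(2) blinfun.diff_left app P.diff PQ B.diff BQ B.zero P.zero)
    then show ?thesis using injD[OF L] by blast
  qed
  have k'0: "?k' 0 h = Q h" for h by (simp add: blinfun.diff_left app \<delta>'0 A.zero)
  have F''_eq: "?F'' h k = \<rho>'' (Q h) (Q k) - P (A (\<delta>'' h k))" for h k
    by (simp add: blinfun.add_left k'0 \<rho>(2) blinfun.minus_left app P.neg)
  have "\<delta>'' h k = inv ?L (B (\<rho>'' (Q h) (Q k)))" for h k
  proof -
    have "?L (\<delta>'' h k) = B (\<rho>'' (Q h) (Q k))"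
      using BF0(2)[of h k] unfolding F''_eq by (simp add: B.diff)
    then show ?thesis using inv_f_f[OF L, of "\<delta>'' h k"] by simp
  qed
  then have "?F'' h k = \<rho>'' (Q h) (Q k) - P (A (inv ?L (B (\<rho>'' (Q h) (Q k)))))" for h k
    using F''_eq by simp
  moreover have "?F' 0 h = Q h" for h
    by (simp only: blinfun_apply_blinfun_compose k'0) (simp add: \<delta>(2) Q.zero A.zero \<rho>(2) PQ)
  ultimately show thesis using that[OF F] by blast
qed

lemma symmetric_form_polarization:
  assumes "subspace T" "sym_bounded_bilinear_on T b" "sym_bounded_bilinear_on T b'"
    and diag: "\<And>v. v \<in> T \<Longrightarrow> b v v = b' v v" and uv: "u \<in> T" "v \<in> T"
  shows "b u v = b' u v"
proof -
  have expand: "b (u + v) (u + v) = b u u + 2 *\<^sub>R b u v + b v v"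
    if "sym_bounded_bilinear_on T b" for b :: "'a \<Rightarrow> 'a \<Rightarrow> 'b"
  proof -
    have sym: "\<And>x y. x \<in> T \<Longrightarrow> y \<in> T \<Longrightarrow> b x y = b y x"
      and add: "\<And>x y z. x \<in> T \<Longrightarrow> y \<in> T \<Longrightarrow> z \<in> T \<Longrightarrow> b (x + y) z = b x z + b y z"
      using that by (simp_all add: sym_bounded_bilinear_on_def)
    have "u + v \<in> T" using assms(1) uv by (simp add: subspace_add)
    then have "b (u + v) (u + v) = b (u + v) u + b (u + v) v"
      using add[OF uv, of "u + v"] sym uv by metis
    also have "\<dots> = b u u + b v u + (b u v + b v v)" using add uv by simp
    finally show ?thesis using sym[OF uv] by (simp add: scaleR_2)
  qed
  have "2 *\<^sub>R b u v = 2 *\<^sub>R b' u v"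
    using expand[OF assms(2)] expand[OF assms(3)] diag[of "u + v"] diag uv assms(1)
    by (simp add: subspace_add)
  then show ?thesis by simp
qed

text \<open>
  The second derivative of \<open>\<rho> = R x \<circ> P\<close> at \<open>0\<close> is symmetric and has the second derivatives of
  \<open>\<alpha> \<mapsto> R x (\<alpha> v)\<close> on its diagonal. It therefore satisfies the condition by which the form is
  chosen, and by polarization any form that satisfies it has the same values on the tangent
  space.
\<close>

lemma retraction_ell_eq:
  fixes R :: "'e::real_normed_vector \<Rightarrow> 'e \<Rightarrow> 'e"
  assumes P: "bounded_projection_onto (tangent_space M x) P"
    and jet: "has_two_derivatives UNIV 0 (\<lambda>z. R x (P z)) \<rho>' \<rho>''"
    and uv: "u \<in> tangent_space M x" "v \<in> tangent_space M x"
  shows "retraction_ell M R x u v = \<rho>'' u v"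
proof -
  define T where "T = tangent_space M x"
  note sT = closed_subspace_projection_range(1)[OF P, folded T_def]
    and PT = closed_subspace_projection_range(3)[OF P, folded T_def]
  interpret \<rho>'': bounded_linear \<rho>'' by (rule has_two_derivativesD(5)[OF jet])
  have first: "vector_derivative (\<lambda>\<beta>. R x (\<beta> *\<^sub>R v)) (at \<alpha>) = \<rho>' (\<alpha> *\<^sub>R v) v" if "v \<in> T" for v \<alpha>
  proof (rule vector_derivative_at)
    have "((\<lambda>\<beta>. \<beta> *\<^sub>R v) has_derivative (\<lambda>t. t *\<^sub>R v)) (at \<alpha>)"
      by (auto intro!: derivative_eq_intros)
    from has_derivative_compose[OF this has_two_derivativesD(3)[OF jet UNIV_I]]
    show "((\<lambda>\<beta>. R x (\<beta> *\<^sub>R v)) has_vector_derivative \<rho>' (\<alpha> *\<^sub>R v) v) (at \<alpha>)"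
      using sT that by (simp add: PT subspace_scale has_vector_derivative_def blinfun.scaleR_right)
  qed
  have second: "((\<lambda>\<alpha>. vector_derivative (\<lambda>\<beta>. R x (\<beta> *\<^sub>R v)) (at \<alpha>)) has_vector_derivative \<rho>'' v v) (at 0)"
    if "v \<in> T" for v
  proof -
    have "((\<lambda>\<alpha>. \<alpha> *\<^sub>R v) has_derivative (\<lambda>t. t *\<^sub>R v)) (at 0)"
      by (auto intro!: derivative_eq_intros)
    then have "((\<lambda>\<alpha>. \<rho>' (\<alpha> *\<^sub>R v)) has_derivative (\<lambda>t. \<rho>'' (t *\<^sub>R v))) (at 0)"
      by (rule has_derivative_compose) (simp add: has_two_derivativesD(4)[OF jet])
    from bounded_linear.has_derivative[OF blinfun.bounded_linear_left this, of v]
    show ?thesis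
      by (simp add: first[OF that] has_vector_derivative_def \<rho>''.scaleR blinfun.scaleR_left)
  qed
  have sym: "sym_bounded_bilinear_on T (\<lambda>u v. \<rho>'' u v)"
    unfolding sym_bounded_bilinear_on_def
  proof (intro conjI ballI allI)
    obtain K where K: "\<And>u. norm (\<rho>'' u) \<le> norm u * K" using \<rho>''.bounded by blast
    have "norm (\<rho>'' u v) \<le> K * norm u * norm v" for u v
      using norm_blinfun[of "\<rho>'' u" v] mult_right_mono[OF K[of u], of "norm v"] by (simp add: mult.commute)
    then show "\<exists>K. \<forall>u\<in>T. \<forall>v\<in>T. norm (\<rho>'' u v) \<le> K * norm u * norm v" by blast
  qed (simp_all add: second_derivative_symmetric[OF jet] \<rho>''.add \<rho>''.scaleR blinfun.add_left blinfun.scaleR_left)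
  let ?p = "\<lambda>b. sym_bounded_bilinear_on T b \<and> (\<forall>v\<in>T.
      ((\<lambda>\<alpha>. vector_derivative (\<lambda>\<beta>. R x (\<beta> *\<^sub>R v)) (at \<alpha>)) has_vector_derivative b v v) (at 0))"
  have "?p (retraction_ell M R x)"
    unfolding retraction_ell_def T_def[symmetric]
    by (rule someI[of ?p "\<lambda>u v. \<rho>'' u v"]) (use sym second in blast)
  then have ell: "sym_bounded_bilinear_on T (retraction_ell M R x)"
    "\<And>v. v \<in> T \<Longrightarrow> retraction_ell M R x v v = \<rho>'' v v"
    using second vector_derivative_unique_at by blast+
  show ?thesis
    using symmetric_form_polarization[OF sT ell(1) sym ell(2)] uv by (simp add: T_def)
qed

text \<open>
  The right-hand side is a bounded bilinear form in \<open>(u, v)\<close>, symmetric because second derivatives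
  are; the operator that represents it by the Riesz theorem is the unique one admitted in the
  definition.
\<close>

lemma pi_op_representation:
  fixes B :: "'e::{real_inner,banach} \<Rightarrow> 'y::real_inner"
  assumes B: "bounded_linear B" and P: "bounded_projection_onto (tangent_space M x) (P x)"
    and L: "invertible_operator (L_op B P x)"
    and jet: "has_two_derivatives UNIV 0 (\<lambda>z. R x (P x z)) \<rho>' \<rho>''"
  shows "inner (pi_op M B P R J x u) v =
    inner (gradient J x) (Lambda_op B P x (\<rho>'' (P x u) (P x v)))"
proof -
  have bl: "bounded_linear (P x)" using P by (simp add: bounded_projection_onto_def)
  note P_in = closed_subspace_projection_range(4)[OF P]
  let ?b = "\<lambda>u v. inner (gradient J x) (Lambda_op B P x (\<rho>'' (P x u) (P x v)))"
  have ell: "retraction_ell M R x (P x u) (P x v) = \<rho>'' (P x u) (P x v)" for u v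
    by (rule retraction_ell_eq[where R=R and x=x and P="P x", OF P jet P_in P_in])
  have sym: "?b u v = ?b v u" for u v
    by (simp add: second_derivative_symmetric[OF jet])
  have "bounded_linear (inv (L_op B P x))" using L by (simp add: invertible_operator_def)
  then have "bounded_linear (\<lambda>w. P x (adjoint B (inv (L_op B P x) (B w))))"
    by (rule bounded_linear_compose[OF bl bounded_linear_compose[OF bounded_linear_adjoint[OF B]
        bounded_linear_compose[OF _ B]]])
  then have "bounded_linear (Lambda_op B P x)"
    unfolding Lambda_op_def by (rule bounded_linear_sub[OF bounded_linear_ident])
  then have \<phi>: "bounded_linear (\<lambda>w. inner (gradient J x) (Lambda_op B P x w))"
    by (rule bounded_linear_compose[OF bounded_linear_inner_right])
  define p where "p u = riesz (Blinfun (\<lambda>w. inner (gradient J x) (Lambda_op B P x w)) o\<^sub>L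
      (\<rho>'' (P x u) o\<^sub>L Blinfun (P x)))" for u
  have p: "inner (p u) v = ?b u v" for u v
    by (simp add: p_def bounded_linear_Blinfun_apply \<phi> bl)
  have "bounded_linear p"
    unfolding p_def
    by (rule bounded_linear_compose[OF bounded_linear_riesz
        bounded_linear_compose[OF bounded_bilinear.bounded_linear_right[OF bounded_bilinear_blinfun_compose]
        bounded_linear_compose[OF bounded_bilinear.bounded_linear_left[OF bounded_bilinear_blinfun_compose]
        bounded_linear_compose[OF has_two_derivativesD(5)[OF jet] bl]]]])
  moreover have "self_adjoint_on UNIV p"
    unfolding self_adjoint_on_def using p sym by (metis UNIV_I inner_commute)
  ultimately have "pi_op M B P R J x = p"
    unfolding pi_op_def ell
  proof (intro the_equality)
    fix q assume "bounded_linear q \<and> self_adjoint_on UNIV q \<and> (\<forall>u v. inner (q u) v = ?b u v)"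
    then have "inner (q u) v = inner (p u) v" for u v using p by simp
    then show "q = p" using vector_eq_rdot by blast
  qed (use p in blast)
  then show ?thesis using p by simp
qed

section \<open>Derivatives of the lifted objective\<close>

theorem theorem4p1:
  fixes M :: "'e::{real_inner,banach} set"
    and B :: "'e \<Rightarrow> 'y::{real_inner,banach}"
    and c :: 'y
    and P :: "'e \<Rightarrow> 'e \<Rightarrow> 'e"
    and R :: "'e \<Rightarrow> 'e \<Rightarrow> 'e"
    and r :: "'e \<Rightarrow> real"
    and \<delta> :: "'e \<Rightarrow> 'e \<Rightarrow> 'y"
    and J :: "'e \<Rightarrow> real"
  assumes "C2_submanifold M"
    and "bounded_linear B" and "surj B"
    and "constraint_set M B c \<noteq> {}"
    and "\<forall>x\<in>M. bounded_projection_onto (tangent_space M x) (P x)"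
    and "\<forall>x\<in>constraint_set M B c. invertible_operator (L_op B P x)"
    and "\<forall>x\<in>M. C2_retraction_at M x (R x)"
    and "\<forall>x\<in>constraint_set M B c.
           r x > 0 \<and>
           C2_on (retraction_domain (constraint_set M B c) r x) (\<delta> x) \<and>
           \<delta> x 0 = 0 \<and>
           (\<forall>v\<in>retraction_domain (constraint_set M B c) r x.
              B (R x (v - P x (adjoint B (\<delta> x v)))) = c)"
    and "C2_on UNIV J"
    and "bdd_below (range J)"
    and "\<forall>a. bounded {x. J x \<le> a}"
    and "\<forall>S. bounded S \<longrightarrow> bounded (gradient J ` S)"
    and "\<forall>S. bounded S \<longrightarrow> bounded ((\<lambda>x. onorm (hessian J x)) ` S)"
  shows "\<forall>x\<in>constraint_set M B c.
    (let MB = constraint_set M B c;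
         T = tangent_space MB x;
         V = retraction_domain MB r x;
         RB = implicit_retraction B P R \<delta> x;
         JB = constrained_objective M B c J;
         Jx = lifted_objective M B c P R \<delta> J x;
         \<pi> = pi_op M B P R J x
     in
       (\<forall>v\<in>T. inner (riemannian_gradient MB JB x) v = inner (gradient_on T Jx 0) v \<and>
               inner (gradient_on T Jx 0) v = inner (gradient J x) v) \<and>
       self_adjoint_on T (hessian_on T Jx 0) \<and>
       (\<forall>v\<in>T. \<forall>u\<in>T. inner (hessian_on T Jx 0 v) u = inner (hessian J x v + \<pi> v) u) \<and>
       (\<forall>v\<in>V. JB (RB v) = Jx v) \<and>
       (\<lambda>v. Jx v - (JB x + inner (riemannian_gradient MB JB x) v
                   + 1/2 * inner (hessian_on T Jx 0 v) v))
         \<in> o[at 0 within T](\<lambda>v. (norm v)\<^sup>2) \<and>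
       (\<lambda>v. Jx v - (J x + inner (gradient J x) v
                   + 1/2 * inner (hessian J x v + \<pi> v) v))
         \<in> o[at 0 within T](\<lambda>v. (norm v)\<^sup>2))"
proof
  fix x assume x: "x \<in> constraint_set M B c"
  define T where "T = tangent_space (constraint_set M B c) x"
  define TM where "TM = tangent_space M x"
  define Jx where "Jx = lifted_objective M B c P R \<delta> J x"
  define \<pi> where "\<pi> = pi_op M B P R J x"
  have xM: "x \<in> M" and Bx: "B x = c" using x by (auto simp: constraint_set_def)
  have B: "bounded_linear B" by (rule assms(2))
  interpret B: bounded_linear B by (rule B)
  have P: "bounded_projection_onto (tangent_space M x) (P x)" using assms(5) xM by blast
  have blP: "bounded_linear (P x)" using P by (simp add: bounded_projection_onto_def)
  interpret P: bounded_linear "P x" by (rule blP)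
  note TM = closed_subspace_projection_range[OF P, folded TM_def]
  have L: "invertible_operator (L_op B P x)" using assms(6) x by blast
  have L_eq: "L_op B P x = (\<lambda>y. B (P x (adjoint B y)))" by (simp add: L_op_def fun_eq_iff)
  have R: "C2_retraction_at M x (R x)" using assms(7) xM by blast
  then have \<rho>: "R x ` TM \<subseteq> M" "R x 0 = x"
    by (auto simp: C2_retraction_at_def TM_def)
  have \<delta>: "r x > 0" "C2_on (retraction_domain (constraint_set M B c) r x) (\<delta> x)" "\<delta> x 0 = 0"
    "\<And>v. v \<in> retraction_domain (constraint_set M B c) r x \<Longrightarrow> B (R x (v - P x (adjoint B (\<delta> x v)))) = c"
    using assms(8) x by auto
  have T_eq: "T = {v \<in> TM. B v = 0}"
    unfolding T_def TM_def by (rule tangent_space_constraint_set[OF B P R L[unfolded L_eq] Bx])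
  have "subspace T"
    unfolding T_eq using TM(1) by (auto simp: subspace_def B.add B.scaleR B.zero)
  moreover have "closed T"
  proof -
    have "T = TM \<inter> {v. B v = 0}" using T_eq by blast
    moreover have "closed {v. B v = 0}"
      by (intro closed_Collect_eq linear_continuous_on B continuous_on_const)
    ultimately show ?thesis using TM(2) by auto
  qed
  ultimately obtain Q where Q: "orthogonal_projection T Q"
    using orthogonal_projection_exists by blast
  note Q' = orthogonal_projectionD[OF Q]
  have QTM: "Q z \<in> TM" and BQ: "B (Q z) = 0" for z using Q'(3)[of z] by (auto simp: T_eq)
  define U where "U = ball (0::'e) (r x)"
  have U: "open U" "0 \<in> U" using \<delta>(1) by (auto simp: U_def)
  have V: "retraction_domain (constraint_set M B c) r x = T \<inter> U"
    by (auto simp: retraction_domain_def T_def U_def)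
  have QU: "Q ` U \<subseteq> T \<inter> U"
    using Q'(3) le_less_trans[OF Q'(6)] by (auto simp: U_def)
  obtain \<rho>' \<rho>'' where jet\<rho>: "has_two_derivatives UNIV 0 (\<lambda>z. R x (P x z)) \<rho>' \<rho>''"
    and \<rho>'0: "\<And>z. \<rho>' 0 z = P x z"
    using retraction_derivatives[OF P R] by blast
  obtain \<delta>' \<delta>'' where jet\<delta>: "has_two_derivatives U 0 (\<lambda>\<xi>. \<delta> x (Q \<xi>)) \<delta>' \<delta>''"
    using C2_on_compose_linear[OF \<delta>(2)[unfolded V] Q'(2) U(1) QU U(2)] by blast
  \<comment> \<open>On \<open>T\<close> this is the implicit retraction; \<open>P x\<close> fixes \<open>Q \<xi>\<close>, so it may be applied to the whole
    argument, and then \<open>F\<close> is a composition of maps defined on open sets.\<close>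
  define F where "F \<xi> = R x (P x (Q \<xi> - adjoint B (\<delta> x (Q \<xi>))))" for \<xi>
  have F_eq: "F \<xi> = R x (Q \<xi> - P x (adjoint B (\<delta> x (Q \<xi>))))" for \<xi>
    by (simp add: F_def P.diff TM(3)[OF QTM])
  obtain F' F'' where jetF: "has_two_derivatives U 0 F F' F''" and F'0: "\<And>h. F' 0 h = Q h"
    and F''0: "\<And>h k. F'' h k = Lambda_op B P x (\<rho>'' (Q h) (Q k))"
  proof (rule implicit_retraction_derivatives[OF B blP bounded_linear_adjoint[OF B] Q'(2) TM(3)[OF QTM] BQ _ jet\<rho> \<rho>'0 jet\<delta>, of c])
    show "inj (\<lambda>y. B (P x (adjoint B y)))"
      using L by (simp add: invertible_operator_def L_eq bij_is_inj)
    show "\<delta> x (Q 0) = 0" using \<delta>(3) Q'(2) by (simp add: bounded_linear.linear linear_0)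
    show "B (R x (P x (Q \<xi> - adjoint B (\<delta> x (Q \<xi>))))) = c" if "\<xi> \<in> U" for \<xi>
      using \<delta>(4)[of "Q \<xi>"] QU that unfolding F_def[symmetric] F_eq V by blast
  qed (use that in \<open>simp add: F_def[abs_def] Lambda_op_def L_eq\<close>)
  have Q0: "Q 0 = 0" using Q'(2) by (simp add: bounded_linear.linear linear_0)
  have F0: "F 0 = x" by (simp add: F_eq Q0 \<delta>(3) bounded_linear.linear[OF bounded_linear_adjoint[OF B]] linear_0 P.zero \<rho>(2))
  have F_constr: "F \<xi> \<in> constraint_set M B c" if "\<xi> \<in> U" for \<xi>
  proof -
    have "B (F \<xi>) = c" using \<delta>(4)[of "Q \<xi>"] QU that unfolding F_eq V by blast
    moreover have "F \<xi> \<in> M" unfolding F_def using \<rho>(1) TM(4) by blast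
    ultimately show ?thesis by (simp add: constraint_set_def)
  qed
  obtain J' J'' where jetJ: "has_two_derivatives UNIV x J J' J''"
    using C2_on_compose_linear[OF assms(9) bounded_linear_ident open_UNIV, of x] by blast
  have gradJ: "gradient J x = riesz (J' x)"
    by (rule gradient_on_restriction[OF orthogonal_projection_UNIV jetJ]) auto
  have hessJ: "hessian J x v = riesz (J'' v)" for v
    by (rule hessian_on_restriction[OF orthogonal_projection_UNIV jetJ]) auto
  define g where "g \<xi> = J (F \<xi>)" for \<xi>
  obtain g' g'' where jetg: "has_two_derivatives U 0 g g' g''" and g'0: "\<And>h. g' 0 h = J' x (Q h)"
    and g''0: "\<And>h k. g'' h k = J'' (Q h) (Q k) + J' x (Lambda_op B P x (\<rho>'' (Q h) (Q k)))"
  proof (rule that)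
    show "has_two_derivatives U 0 g (\<lambda>\<xi>. J' (F \<xi>) o\<^sub>L F' \<xi>) (\<lambda>h. (J'' (F' 0 h) o\<^sub>L F' 0) + (J' (F 0) o\<^sub>L F'' h))"
      unfolding g_def[abs_def]
      by (rule has_two_derivatives_compose[OF jetF, where U=UNIV]) (use jetJ F0 in auto)
  qed (simp_all add: F0 F'0 F''0 blinfun.add_left)
  have Jx_eq: "Jx \<xi> = g \<xi>" if "\<xi> \<in> U" "\<xi> \<in> T" for \<xi>
    using F_constr[OF that(1)] Q'(4)[OF that(2)]
    by (simp add: Jx_def g_def lifted_objective_def constrained_objective_def implicit_retraction_def F_eq)
  have gradJx: "gradient_on T Jx 0 = Q (riesz (g' 0))"
    by (rule gradient_on_restriction[OF Q jetg Jx_eq U(2)]) (use Q'(3)[of 0] Q0 in auto)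
  have zT: "0 \<in> T" using Q'(1) by (rule subspace_0)
  have hessJx: "hessian_on T Jx 0 v = Q (riesz (g'' v))" if "v \<in> T" for v
    by (rule hessian_on_restriction[OF Q jetg Jx_eq zT that])
  have rgrad: "riemannian_gradient (constraint_set M B c) (constrained_objective M B c J) x = Q (riesz (J' x))"
    by (rule riemannian_gradient_restriction[OF Q[unfolded T_def] has_two_derivativesD(3)[OF jetJ UNIV_I]])
      (simp add: constrained_objective_def)
  have grad: "inner (riemannian_gradient (constraint_set M B c) (constrained_objective M B c J) x) v = J' x v"
    "inner (gradient_on T Jx 0) v = J' x v" "inner (gradient J x) v = J' x v" "g' 0 v = J' x v" if "v \<in> T" for v
    using that by (simp_all add: rgrad gradJx gradJ Q'(4,5) g'0)
  have hess: "inner (hessian_on T Jx 0 v) u = g'' v u" if "v \<in> T" "u \<in> T" for v u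
    using that by (simp add: hessJx Q'(5))
  have hess_pi: "inner (hessian J x v + \<pi> v) u = g'' v u" if "v \<in> T" "u \<in> T" for v u
  proof -
    have "v \<in> TM" "u \<in> TM" using that by (auto simp: T_eq)
    then show ?thesis
      using that pi_op_representation[where M=M and P=P and R=R and x=x, OF B P L jet\<rho>, of J v u]
      by (simp add: \<pi>_def inner_add_left hessJ g''0 Q'(4) TM(3) gradJ)
  qed
  have self_adjoint: "self_adjoint_on T (hessian_on T Jx 0)"
    unfolding self_adjoint_on_def
  proof (intro conjI ballI)
    show "hessian_on T Jx 0 v \<in> T" if "v \<in> T" for v using that by (simp add: hessJx Q'(3))
    show "inner (hessian_on T Jx 0 u) v = inner u (hessian_on T Jx 0 v)" if "u \<in> T" "v \<in> T" for u v
      using hess[OF that] hess[OF that(2,1)] second_derivative_symmetric[OF jetg, of u v] by (simp add: inner_commute)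
  qed
  have taylor: "(\<lambda>v. Jx v - (J x + J' x v + 1/2 * g'' v v)) \<in> o[at 0 within T](\<lambda>v. (norm v)\<^sup>2)"
  proof -
    have "(\<lambda>v. g (0 + v) - (g 0 + g' 0 v + (1/2) *\<^sub>R g'' v v)) \<in> o[at 0 within T](\<lambda>v. (norm v)\<^sup>2)"
      by (rule landau_o.small.filter_mono[OF at_le[OF subset_UNIV] second_order_taylor[OF jetg]])
    moreover have "\<forall>\<^sub>F v in at 0 within T. g (0 + v) - (g 0 + g' 0 v + (1/2) *\<^sub>R g'' v v) =
        Jx v - (J x + J' x v + 1/2 * g'' v v)"
      unfolding eventually_at_topological
      using U Jx_eq grad(4) F0 by (intro exI[of _ U]) (auto simp: g_def)
    ultimately show ?thesis by (rule landau_o.small.in_cong[THEN iffD1, rotated])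
  qed
  have JBx: "constrained_objective M B c J x = J x" using x by (simp add: constrained_objective_def)
  have ev: "\<forall>\<^sub>F v in at 0 within T. v \<in> T" by (simp add: eventually_at_filter)
  have taylor1: "(\<lambda>v. Jx v - (constrained_objective M B c J x
       + inner (riemannian_gradient (constraint_set M B c) (constrained_objective M B c J) x) v
       + 1/2 * inner (hessian_on T Jx 0 v) v)) \<in> o[at 0 within T](\<lambda>v. (norm v)\<^sup>2)"
    by (rule iffD1[OF landau_o.small.in_cong taylor]) (use ev in \<open>eventually_elim, simp add: JBx grad hess\<close>)
  have taylor2: "(\<lambda>v. Jx v - (J x + inner (gradient J x) v + 1/2 * inner (hessian J x v + \<pi> v) v))
       \<in> o[at 0 within T](\<lambda>v. (norm v)\<^sup>2)"
    by (rule iffD1[OF landau_o.small.in_cong taylor]) (use ev in \<open>eventually_elim, simp add: grad hess_pi\<close>)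
  show "let MB = constraint_set M B c;
         T = tangent_space MB x;
         V = retraction_domain MB r x;
         RB = implicit_retraction B P R \<delta> x;
         JB = constrained_objective M B c J;
         Jx = lifted_objective M B c P R \<delta> J x;
         \<pi> = pi_op M B P R J x
     in
       (\<forall>v\<in>T. inner (riemannian_gradient MB JB x) v = inner (gradient_on T Jx 0) v \<and>
               inner (gradient_on T Jx 0) v = inner (gradient J x) v) \<and>
       self_adjoint_on T (hessian_on T Jx 0) \<and>
       (\<forall>v\<in>T. \<forall>u\<in>T. inner (hessian_on T Jx 0 v) u = inner (hessian J x v + \<pi> v) u) \<and>
       (\<forall>v\<in>V. JB (RB v) = Jx v) \<and>
       (\<lambda>v. Jx v - (JB x + inner (riemannian_gradient MB JB x) v
                   + 1/2 * inner (hessian_on T Jx 0 v) v))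
         \<in> o[at 0 within T](\<lambda>v. (norm v)\<^sup>2) \<and>
       (\<lambda>v. Jx v - (J x + inner (gradient J x) v
                   + 1/2 * inner (hessian J x v + \<pi> v) v))
         \<in> o[at 0 within T](\<lambda>v. (norm v)\<^sup>2)"
    unfolding Let_def T_def[symmetric] Jx_def[symmetric] \<pi>_def[symmetric]
    using grad hess hess_pi self_adjoint taylor1 taylor2
    by (intro conjI) (simp_all add: Jx_def lifted_objective_def)
qed

end
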